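(* Fix $d\geq 2$, an open subset $\Omega\subset\mathbb{R}^d$, and an integer $\ell\in[1,d-1]$. Let $P$ be a Borel probability measure on $\mathbb{R}^d$, and assume that $P$ admits a density $f_\Omega\in L^1(\Omega)$ over $\Omega$ with respect to the Lebesgue measure. (i) If $f_\Omega\in L^p_{\mathrm{loc}}(\Omega)$ for some $p\in(d/(d-\ell),\infty]$, then $F_P^{\mathrm g}\in\mathcal{C}^\ell(\Omega)$ and $$(\partial^\alpha F_P^{\mathrm g})(x)=\mathbb{E}\big[(\partial^\alpha K)(x-Z)\big]\quad\text{for all }x\in\Omega$$ and all $\alpha\in\mathbb{N}^d$ with $|\alpha|\leq\ell$, where $Z$ is a random vector with law $P$. (ii) If $\Omega=\mathbb{R}^d$ and the density belongs to $L^p(\mathbb{R}^d)$ for some $p\in(d/(d-\ell),\infty]$, then $\partial^\alpha F_P^{\mathrm g}$ converges to $0$ at infinity for any $\alpha\in\mathbb{N}^d$ such that $1\leq|\alpha|\leq\ell$.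
   Context: $F_P^{\mathrm g}:\mathbb{R}^d\to\mathbb{R}^d$ is the geometric cdf of $P$: $F_P^{\mathrm g}(x)=\mathbb{E}\big[\frac{x-Z}{\|x-Z\|}\mathbb{I}[Z\neq x]\big]=\mathbb{E}[K(x-Z)]$ with $Z\sim P$, where $K:\mathbb{R}^d\to\mathbb{R}^d$ is $K(x)=\frac{x}{\|x\|}\mathbb{I}[x\neq 0]$. $\partial^\alpha K$ denotes the classical derivative of $K$ on $\mathbb{R}^d\setminus\{0\}$ (its value at $0$ is irrelevant, since $P[\{x\}]=0$ for $x\in\Omega$). $P$ admits the density $f_\Omega$ over $\Omega$ if $P(E)=\int_E f_\Omega(z)\,dz$ for all Borel sets $E\subset\Omega$ (nothing is assumed about $P$ outside $\Omega$). *)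

theory Defs
  imports "HOL-Probability.Probability"
begin

definition geom_kernel :: "real ^ 'n \<Rightarrow> real ^ 'n" where
  "geom_kernel x = (if x = 0 then 0 else x /\<^sub>R norm x)"

lemma geom_kernel_eq_sgn: "geom_kernel = sgn"
  by (auto simp: geom_kernel_def sgn_div_norm fun_eq_iff)

definition geom_cdf :: "(real ^ 'n) measure \<Rightarrow> real ^ 'n \<Rightarrow> real ^ 'n" where
  "geom_cdf P x = (LINT z|P. geom_kernel (x - z))"

definition has_partial_at :: "'n::finite \<Rightarrow> (real ^ 'n \<Rightarrow> 'b::real_normed_vector) \<Rightarrow> real ^ 'n \<Rightarrow> bool" where
  "has_partial_at i f x \<longleftrightarrow> (\<lambda>t. f (x + t *\<^sub>R axis i 1)) differentiable (at 0)"

(* Meaningful only at points where has_partial_at holds. *)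
definition partial :: "'n::finite \<Rightarrow> (real ^ 'n \<Rightarrow> 'b::real_normed_vector) \<Rightarrow> real ^ 'n \<Rightarrow> 'b" where
  "partial i f x = vector_derivative (\<lambda>t. f (x + t *\<^sub>R axis i 1)) (at 0)"

(* All iterated partial derivatives of order at most k, in every order of
   differentiation, exist and are continuous on the (open) set S. *)
primrec C_on :: "nat \<Rightarrow> (real ^ 'n::finite \<Rightarrow> 'b::real_normed_vector) \<Rightarrow> (real ^ 'n) set \<Rightarrow> bool" where
  "C_on 0 f S \<longleftrightarrow> continuous_on S f"
| "C_on (Suc k) f S \<longleftrightarrow> continuous_on S f \<and>
     (\<forall>i. (\<forall>x\<in>S. has_partial_at i f x) \<and> C_on k (partial i f) S)"

(* A multi-index is a vector of naturals. The index type carries no order, so the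
   coordinates are enumerated once and for all. The choice of enumeration is immaterial
   for functions that are C^k on an open set with k at least the order of the derivative. *)
definition coord_list :: "'n::finite list" where
  "coord_list = (SOME xs. distinct xs \<and> set xs = UNIV)"

definition mi_order :: "nat ^ 'n::finite \<Rightarrow> nat" where
  "mi_order \<alpha> = (\<Sum>i\<in>UNIV. \<alpha> $ i)"

definition mi_deriv :: "nat ^ 'n::finite \<Rightarrow> (real ^ 'n \<Rightarrow> 'b::real_normed_vector) \<Rightarrow> real ^ 'n \<Rightarrow> 'b" where
  "mi_deriv \<alpha> f = foldr (\<lambda>i. partial i ^^ (\<alpha> $ i)) coord_list f"

(* Membership of f in L^p(S) for an exponent p in [1,\<infinity>]; the values of f outside S play no role. *)
definition Lp_on :: "ennreal \<Rightarrow> 'a::euclidean_space set \<Rightarrow> ('a \<Rightarrow> real) \<Rightarrow> bool" where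
  "Lp_on p S f \<longleftrightarrow> set_borel_measurable lebesgue S f \<and>
     (if p = \<infinity> then \<exists>C. AE x\<in>S in lebesgue. \<bar>f x\<bar> \<le> C
      else set_integrable lebesgue S (\<lambda>x. \<bar>f x\<bar> powr enn2real p))"

definition Lp_loc_on :: "ennreal \<Rightarrow> 'a::euclidean_space set \<Rightarrow> ('a \<Rightarrow> real) \<Rightarrow> bool" where
  "Lp_loc_on p S f \<longleftrightarrow> (\<forall>K. compact K \<and> K \<subseteq> S \<longrightarrow> Lp_on p K f)"

(* f is in L^1(S) and is the density of P over S; P is unconstrained outside S. *)
definition has_density_over :: "'a::euclidean_space measure \<Rightarrow> ('a \<Rightarrow> real) \<Rightarrow> 'a set \<Rightarrow> bool" where
  "has_density_over P f S \<longleftrightarrow> set_integrable lebesgue S f \<and>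
     (\<forall>E\<in>sets borel. E \<subseteq> S \<longrightarrow> measure P E = (LINT z:E|lebesgue. f z))"

end

theory Submission
  imports Defs
begin

text \<open>
  The geometric cdf is the convolution of $P$ with the kernel $K(x) = x/|x|$, and the theorem is
  differentiation under the integral sign up to the order at which the differentiated kernel is still
  uniformly integrable against $P$.

  The kernel is smooth and homogeneous of degree $0$ off the origin. Hence a derivative of order $k$ is
  homogeneous of degree $-k$ (\<open>homogeneous_kernel_partial\<close>), and compactness of the sphere bounds it by $C/|x|^k$
  (\<open>homogeneous_kernel_bound\<close>). This bound replaces explicit formulas for the derivatives.

  Near its singularity such a kernel is integrated against the density $f$, and
  $\<integral>_{|x-z|<\<delta>} |x-z|^{-k} |f(z)| dz$ tends to $0$ with $\<delta>$, uniformly in $x$, as soon as $f \<in> L^p$ with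
  $p > d/(d-k)$: the conjugate exponent $q$ satisfies $kq < d$, so $|z|^{-kq}$ is locally integrable
  (\<open>riesz_small_of_Lp\<close>). It follows that the convolution of $P$ with the kernel is a uniform limit of
  convolutions with truncated, bounded continuous kernels. This makes it continuous
  (\<open>conv_continuous\<close>), and it also gives the limit $0$ at infinity when $k \<ge> 1$
  (\<open>conv_tendsto_0_at_infinity\<close>).

  To differentiate, one integrates instead. Along a segment in direction $e_i$ the fundamental theorem
  of calculus expresses the increment of a kernel $g$ by $\<partial>_i g$, for every $z$ off the segment. A
  segment in dimension at least $2$ is a null set, so this holds almost surely. Fubini's theorem turns it into the
  same identity between the convolutions of $P$ with $g$ and with $\<partial>_i g$
  (\<open>conv_FTC_line\<close>). Since the latter is continuous, it is the partial derivative of the former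
  (\<open>conv_has_partial\<close>), and induction on the order finishes the proof.
\<close>

section \<open>Calculus of iterated partial derivatives\<close>

lemma partialI:
  assumes "((\<lambda>t. f (x + t *\<^sub>R axis i 1)) has_vector_derivative D) (at 0)"
  shows "has_partial_at i f x" "partial i f x = D"
  using assms unfolding has_partial_at_def partial_def
  by (auto intro: differentiableI_vector vector_derivative_at)

lemma has_partialD:
  assumes "has_partial_at i f x"
  shows "((\<lambda>t. f (x + t *\<^sub>R axis i 1)) has_vector_derivative partial i f x) (at 0)"
  using assms unfolding has_partial_at_def partial_def by (simp add: vector_derivative_works)

lemma eventually_line_mem:
  fixes x v :: "'a::real_normed_vector"
  assumes "open S" "x \<in> S"
  shows "eventually (\<lambda>t::real. x + t *\<^sub>R v \<in> S) (nhds 0)"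
proof -
  have "((\<lambda>t::real. x + t *\<^sub>R v) \<longlongrightarrow> x + 0 *\<^sub>R v) (nhds 0)"
    by (intro tendsto_intros filterlim_ident)
  then show ?thesis using topological_tendstoD[of _ "x" "nhds 0" S] assms by simp
qed

text \<open>
  Partial derivatives are local: on an open set they see only the values on that set. This is what
  allows a formula that is known only on the open set to be differentiated again.
\<close>
lemma partial_cong:
  assumes "open S" "x \<in> S" "\<And>y. y \<in> S \<Longrightarrow> f y = g y"
  shows "partial i f x = partial i g x"
  unfolding partial_def
proof (rule vector_derivative_cong_eq)
  show "\<forall>\<^sub>F t in nhds 0. t \<in> UNIV \<longrightarrow> f (x + t *\<^sub>R axis i 1) = g (x + t *\<^sub>R axis i 1)"
    using eventually_line_mem[OF assms(1,2)] by eventually_elim (use assms(3) in auto)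
qed auto

lemma has_vector_derivative_line_cong:
  fixes v :: "'a::real_normed_vector"
  assumes "open S" "x \<in> S" "\<And>y. y \<in> S \<Longrightarrow> f y = g y"
    and "((\<lambda>t. f (x + t *\<^sub>R v)) has_vector_derivative D) (at 0)"
  shows "((\<lambda>t. g (x + t *\<^sub>R v)) has_vector_derivative D) (at 0)"
proof -
  have ev: "eventually (\<lambda>t. f (x + t *\<^sub>R v) = g (x + t *\<^sub>R v)) (nhds 0)"
    using eventually_line_mem[OF assms(1,2)] by eventually_elim (use assms(3) in auto)
  show ?thesis
    using assms(4) has_vector_derivative_cong_ev[where x=0 and S=UNIV and f="\<lambda>t. f (x + t *\<^sub>R v)" and g="\<lambda>t. g (x + t *\<^sub>R v)"] ev
      assms(2,3) by (auto elim: eventually_mono)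
qed

lemma C_on_cong:
  assumes "open S" "\<And>y. y \<in> S \<Longrightarrow> f y = g y" "C_on k f S"
  shows "C_on k g S"
  using assms(2,3)
proof (induction k arbitrary: f g)
  case 0
  then show ?case by (simp cong: continuous_on_cong)
next
  case (Suc k)
  have "continuous_on S g" using Suc.prems by (simp cong: continuous_on_cong)
  moreover have "has_partial_at i g x" if "x \<in> S" for i x
    using Suc.prems that
    by (intro partialI(1)[OF has_vector_derivative_line_cong[OF assms(1) that, of f g _ "partial i f x"]] has_partialD) simp_all
  moreover have "C_on k (partial i g) S" for i
  proof (rule Suc.IH)
    show "partial i f y = partial i g y" if "y \<in> S" for y
      by (rule partial_cong[OF assms(1) that Suc.prems(1)])
    show "C_on k (partial i f) S" using Suc.prems(2) by simp
  qed
  ultimately show ?case by simp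
qed

text \<open>
  The derivative may be guessed: it is enough to exhibit, on the open set, functions $D_i$ that are
  the partial derivatives of $f$ there. The smoothness proofs below go through this rule.
\<close>
lemma C_on_SucI:
  assumes "open S" "continuous_on S f"
    and "\<And>i x. x \<in> S \<Longrightarrow> ((\<lambda>t. f (x + t *\<^sub>R axis i 1)) has_vector_derivative D i x) (at 0)"
    and "\<And>i. C_on k (D i) S"
  shows "C_on (Suc k) f S"
proof -
  have "C_on k (partial i f) S" for i
    using partialI(2)[OF assms(3)] by (intro C_on_cong[OF assms(1) _ assms(4)[of i]]) auto
  then show ?thesis using assms partialI(1)[OF assms(3)] by simp
qed

lemma C_on_imp_continuous_on: "C_on k f S \<Longrightarrow> continuous_on S f"
  by (cases k) auto

lemma C_on_Suc_lower: "C_on (Suc k) f S \<Longrightarrow> C_on k f S"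
proof (induction k arbitrary: f)
  case (Suc k)
  have "C_on (Suc k) (partial i f) S" for i
    using Suc.prems unfolding C_on.simps(2)[of "Suc k"] by (elim conjE allE)
  then have "C_on k (partial i f) S" for i by (rule Suc.IH)
  then show ?case using Suc.prems by simp
qed auto

lemma C_on_const: "open S \<Longrightarrow> C_on k (\<lambda>x. c) S"
proof (induction k arbitrary: c)
  case (Suc k)
  show ?case
    by (rule C_on_SucI[where D="\<lambda>i x. 0"]) (use Suc in auto)
qed auto

lemma C_on_linear:
  assumes "bounded_linear L" "open S"
  shows "C_on k L S"
proof (cases k)
  case 0
  then show ?thesis using assms by (simp add: linear_continuous_on)
next
  case (Suc m)
  interpret L: bounded_linear L by fact
  have "C_on (Suc m) L S"
  proof (rule C_on_SucI[where D="\<lambda>i x. L (axis i 1)"])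
    show "((\<lambda>t. L (x + t *\<^sub>R axis i 1)) has_vector_derivative L (axis i 1)) (at 0)" for x i
      unfolding L.add L.scaleR by (auto intro!: derivative_eq_intros)
  qed (use assms in \<open>auto intro: linear_continuous_on C_on_const\<close>)
  then show ?thesis using Suc by simp
qed

lemma C_on_add:
  assumes "open S" "C_on k f S" "C_on k g S"
  shows "C_on k (\<lambda>x. f x + g x) S"
  using assms(2,3)
proof (induction k arbitrary: f g)
  case 0
  then show ?case by (auto intro: continuous_intros)
next
  case (Suc k)
  show ?case
  proof (rule C_on_SucI[where D="\<lambda>i x. partial i f x + partial i g x"])
    show "((\<lambda>t. f (x + t *\<^sub>R axis i 1) + g (x + t *\<^sub>R axis i 1)) has_vector_derivative
            partial i f x + partial i g x) (at 0)" if "x \<in> S" for i x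
      by (intro has_vector_derivative_add has_partialD) (use Suc.prems that in auto)
  qed (use Suc assms in \<open>auto intro: continuous_intros\<close>)
qed

lemma C_on_scaleR:
  fixes a :: "real ^ 'n \<Rightarrow> real"
  assumes "open S" "C_on k a S" "C_on k f S"
  shows "C_on k (\<lambda>x. a x *\<^sub>R f x) S"
  using assms(2,3)
proof (induction k arbitrary: a f)
  case 0
  then show ?case by (auto intro: continuous_intros)
next
  case (Suc k)
  show ?case
  proof (rule C_on_SucI[where D="\<lambda>i x. a x *\<^sub>R partial i f x + partial i a x *\<^sub>R f x"])
    show "((\<lambda>t. a (x + t *\<^sub>R axis i 1) *\<^sub>R f (x + t *\<^sub>R axis i 1)) has_vector_derivative
            a x *\<^sub>R partial i f x + partial i a x *\<^sub>R f x) (at 0)" if "x \<in> S" for i x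
    proof -
      have "((\<lambda>t. a (x + t *\<^sub>R axis i 1)) has_field_derivative partial i a x) (at 0)"
        unfolding has_real_derivative_iff_has_vector_derivative
        by (rule has_partialD) (use Suc.prems that in auto)
      from has_vector_derivative_scaleR[OF this has_partialD[of i f x]] show ?thesis
        using Suc.prems that by auto
    qed
    show "C_on k (\<lambda>x. a x *\<^sub>R partial i f x + partial i a x *\<^sub>R f x) S" for i
      using Suc.prems C_on_Suc_lower[of k f S] C_on_Suc_lower[of k a S]
      by (intro C_on_add Suc.IH assms(1)) auto
  qed (use Suc assms in \<open>auto intro: continuous_intros\<close>)
qed

text \<open>
  A multi-index derivative is one particular sequence of first-order derivatives, so statements about
  it follow by induction on the list of directions.
\<close>
lemma mi_deriv_eq_foldr_partial:
  fixes \<alpha> :: "nat ^ 'n::finite"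
  obtains js where "length js = mi_order \<alpha>"
    "\<And>f :: real ^ 'n \<Rightarrow> 'b::real_normed_vector. mi_deriv \<alpha> f = foldr partial js f"
proof -
  have "\<exists>xs::'n list. distinct xs \<and> set xs = UNIV"
    using finite_distinct_list[of "UNIV :: 'n set"] by auto
  from someI_ex[OF this] have cl: "distinct (coord_list::'n list)" "set (coord_list::'n list) = UNIV"
    unfolding coord_list_def by auto
  define js where "js = concat (map (\<lambda>i. replicate (\<alpha> $ i) i) coord_list)"
  have "length js = mi_order \<alpha>"
    using cl by (simp add: js_def length_concat o_def mi_order_def sum_list_distinct_conv_sum_set)
  moreover have rep: "foldr h (replicate n i) = h i ^^ n" for h :: "'n \<Rightarrow> 'c \<Rightarrow> 'c" and n i
    by (induction n) (auto simp: fun_eq_iff)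
  have "foldr (\<lambda>i. partial i ^^ (\<alpha> $ i)) xs f = foldr partial (concat (map (\<lambda>i. replicate (\<alpha> $ i) i) xs)) f"
    for xs and f :: "real ^ 'n \<Rightarrow> 'b"
    by (induction xs) (auto simp: rep)
  ultimately show ?thesis by (intro that[of "js"]) (auto simp: js_def mi_deriv_def)
qed

section \<open>Homogeneous kernels\<close>

text \<open>
  The function $u = 1/|x|$ satisfies $\<partial>_i u = - x_i u^3$. Its derivatives are therefore products of
  coordinates and of $u$ itself, and smoothness of $u$ follows by induction with the product rule.
\<close>
lemma inverse_norm_C_on: "C_on m (\<lambda>x::real^'n::finite. inverse (norm x)) (- {0})"
proof (induction m)
  case 0
  then show ?case by (auto intro!: continuous_intros)
next
  case (Suc m)
  let ?u = "\<lambda>x::real^'n. inverse (norm x)"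
  have op: "open (- {0 :: real^'n})" by auto
  show ?case
  proof (rule C_on_SucI[where D="\<lambda>i x. (- 1) *\<^sub>R ((x $ i) *\<^sub>R (?u x *\<^sub>R (?u x *\<^sub>R ?u x)))"])
    show "((\<lambda>t. inverse (norm (x + t *\<^sub>R axis i 1))) has_vector_derivative
            (- 1) *\<^sub>R ((x $ i) *\<^sub>R (?u x *\<^sub>R (?u x *\<^sub>R ?u x)))) (at 0)"
      if "x \<in> - {0}" for i and x :: "real^'n"
    proof -
      have "x \<noteq> 0" using that by auto
      have line: "((\<lambda>t::real. x + t *\<^sub>R axis i 1) has_derivative (\<lambda>t. t *\<^sub>R axis i 1)) (at 0)"
        by (auto intro!: derivative_eq_intros)
      have "(norm has_derivative (\<lambda>h. h \<bullet> sgn x)) (at (x + 0 *\<^sub>R axis i 1))"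
        using has_derivative_norm[OF \<open>x \<noteq> 0\<close>] by (simp add: inner_commute)
      from has_derivative_compose[OF line this]
      have "((\<lambda>t. norm (x + t *\<^sub>R axis i 1)) has_derivative (\<lambda>t. t *\<^sub>R axis i 1 \<bullet> sgn x)) (at 0)" .
      from Deriv.has_derivative_inverse[OF _ this] \<open>x \<noteq> 0\<close>
      have "((\<lambda>t. inverse (norm (x + t *\<^sub>R axis i 1))) has_derivative
          (\<lambda>t. - (?u x * (t *\<^sub>R axis i 1 \<bullet> sgn x) * ?u x))) (at 0)"
        by simp
      moreover have "(\<lambda>t. - (?u x * (t *\<^sub>R axis i 1 \<bullet> sgn x) * ?u x))
          = (\<lambda>t. t *\<^sub>R ((- 1) *\<^sub>R ((x $ i) *\<^sub>R (?u x *\<^sub>R (?u x *\<^sub>R ?u x)))))"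
        by (simp add: fun_eq_iff sgn_div_norm inner_axis' mult_ac)
      ultimately show ?thesis unfolding has_vector_derivative_def by simp
    qed
    show "C_on m (\<lambda>x. (- 1) *\<^sub>R ((x $ i) *\<^sub>R (?u x *\<^sub>R (?u x *\<^sub>R ?u x)))) (- {0})" for i
      by (intro C_on_scaleR C_on_const Suc op C_on_linear bounded_linear_vec_nth)
  qed (auto intro!: continuous_intros)
qed

text \<open>
  Smooth away from the origin and positively homogeneous of degree $-k$. The value at the origin is
  left open, since it is arbitrary for the iterated partial derivatives of the geometric kernel.
\<close>
definition homogeneous_kernel :: "nat \<Rightarrow> (real ^ 'n::finite \<Rightarrow> real ^ 'n) \<Rightarrow> bool" where
  "homogeneous_kernel k g \<longleftrightarrow> (\<forall>m. C_on m g (- {0})) \<and>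
     (\<forall>c x. c > 0 \<longrightarrow> x \<noteq> 0 \<longrightarrow> g (c *\<^sub>R x) = inverse c ^ k *\<^sub>R g x)"

lemma homogeneous_geom_kernel: "homogeneous_kernel 0 (geom_kernel :: real ^ 'n::finite \<Rightarrow> _)"
  unfolding homogeneous_kernel_def
proof (intro conjI allI impI)
  fix m
  have op: "open (- {0 :: real^'n})" by auto
  show "C_on m geom_kernel (- {0 :: real^'n})"
    by (rule C_on_cong[OF op _ C_on_scaleR[OF op inverse_norm_C_on C_on_linear[OF bounded_linear_ident op]]])
       (auto simp: geom_kernel_def)
qed (auto simp: geom_kernel_def)

lemma homogeneous_kernel_continuous: "homogeneous_kernel k g \<Longrightarrow> continuous_on (- {0}) g"
  unfolding homogeneous_kernel_def using C_on_imp_continuous_on by blast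

lemma homogeneous_kernel_has_partial:
  assumes "homogeneous_kernel k g" "x \<noteq> 0"
  shows "((\<lambda>t. g (x + t *\<^sub>R axis i 1)) has_vector_derivative partial i g x) (at 0)"
proof (rule has_partialD)
  have "C_on (Suc 0) g (- {0})" using assms(1) unfolding homogeneous_kernel_def by blast
  then show "has_partial_at i g x" using assms(2) by simp
qed

text \<open>
  Differentiating $g(cx) = c^{-k} g(x)$ by the chain rule lowers the degree of homogeneity by one. So
  the growth of every derivative of the geometric kernel is known without computing it.
\<close>
lemma homogeneous_kernel_partial:
  fixes g :: "real ^ 'n::finite \<Rightarrow> real ^ 'n"
  assumes "homogeneous_kernel k g"
  shows "homogeneous_kernel (Suc k) (partial i g)"
  unfolding homogeneous_kernel_def
proof (intro conjI allI impI)
  fix m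
  have "C_on (Suc m) g (- {0})" using assms unfolding homogeneous_kernel_def by blast
  then show "C_on m (partial i g) (- {0})" by simp
next
  fix c :: real and x :: "real ^ 'n"
  assume c: "c > 0" and x: "x \<noteq> 0"
  have hom: "g y = inverse c ^ k *\<^sub>R g (inverse c *\<^sub>R y)" if "y \<in> - {0}" for y
  proof -
    have "inverse c *\<^sub>R y \<noteq> 0" using c that by simp
    then have "g (c *\<^sub>R (inverse c *\<^sub>R y)) = inverse c ^ k *\<^sub>R g (inverse c *\<^sub>R y)"
      using assms c unfolding homogeneous_kernel_def by blast
    then show ?thesis using c by simp
  qed
  have op: "open (- {0 :: real^'n})" by auto
  have d: "((\<lambda>t. g (x + t *\<^sub>R axis i 1)) has_vector_derivative partial i g x) (at (inverse c * 0))"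
    using homogeneous_kernel_has_partial[OF assms x] by simp
  have "((\<lambda>t. inverse c *\<^sub>R t) has_vector_derivative inverse c) (at (0::real))"
    by (auto intro!: derivative_eq_intros)
  from vector_diff_chain_at[OF this] d
  have "((\<lambda>t. g (x + (inverse c * t) *\<^sub>R axis i 1)) has_vector_derivative inverse c *\<^sub>R partial i g x) (at 0)"
    by (simp add: o_def)
  then have "((\<lambda>t. inverse c ^ k *\<^sub>R g (x + (inverse c * t) *\<^sub>R axis i 1)) has_vector_derivative
     inverse c ^ k *\<^sub>R inverse c *\<^sub>R partial i g x) (at 0)"
    by (rule bounded_linear.has_vector_derivative[OF bounded_linear_scaleR_right])
  moreover have "inverse c *\<^sub>R (c *\<^sub>R x + t *\<^sub>R axis i 1) = x + (inverse c * t) *\<^sub>R axis i 1" for t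
    using c by (simp add: scaleR_add_right)
  ultimately have "((\<lambda>t. inverse c ^ k *\<^sub>R g (inverse c *\<^sub>R (c *\<^sub>R x + t *\<^sub>R axis i 1))) has_vector_derivative
     inverse c ^ Suc k *\<^sub>R partial i g x) (at 0)"
    by (simp add: mult.commute)
  then have "((\<lambda>t. g (c *\<^sub>R x + t *\<^sub>R axis i 1)) has_vector_derivative inverse c ^ Suc k *\<^sub>R partial i g x) (at 0)"
  proof (rule has_vector_derivative_line_cong[OF op, rotated 2])
    show "inverse c ^ k *\<^sub>R g (inverse c *\<^sub>R y) = g y" if "y \<in> - {0}" for y
      using hom[OF that] by (rule sym)
    show "c *\<^sub>R x \<in> - {0}" using c x by simp
  qed
  from partialI(2)[OF this] show "partial i g (c *\<^sub>R x) = inverse c ^ Suc k *\<^sub>R partial i g x" .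
qed

text \<open>
  The unit sphere is compact, hence $g$ is bounded on it, and homogeneity spreads this bound
  radially.
\<close>
lemma homogeneous_kernel_bound:
  assumes "homogeneous_kernel k g"
  obtains C where "C > 0" "\<And>y. y \<noteq> 0 \<Longrightarrow> norm (g y) \<le> C / norm y ^ k"
proof -
  have "continuous_on (sphere 0 1) g"
    using homogeneous_kernel_continuous[OF assms] by (rule continuous_on_subset) auto
  then have "bounded (g ` sphere 0 1)"
    by (intro compact_imp_bounded compact_continuous_image) auto
  then obtain C where C: "C > 0" "\<And>y. y \<in> sphere 0 1 \<Longrightarrow> norm (g y) \<le> C"
    unfolding bounded_pos by auto
  have "norm (g y) \<le> C / norm y ^ k" if "y \<noteq> 0" for y
  proof -
    have "g (norm y *\<^sub>R sgn y) = inverse (norm y) ^ k *\<^sub>R g (sgn y)"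
      using assms that unfolding homogeneous_kernel_def by (simp add: sgn_zero_iff)
    then have "norm (g y) = inverse (norm y) ^ k * norm (g (sgn y))"
      using that by (simp add: sgn_div_norm)
    also have "\<dots> \<le> inverse (norm y) ^ k * C"
      using C(2)[of "sgn y"] that by (intro mult_left_mono) (auto simp: norm_sgn)
    finally show ?thesis by (simp add: divide_inverse power_inverse mult.commute)
  qed
  with C(1) show ?thesis by (rule that)
qed

lemma homogeneous_kernel_measurable:
  assumes "homogeneous_kernel k g"
  shows "g \<in> borel_measurable borel"
  by (rule borel_measurable_continuous_countable_exceptions[of "{0}"])
     (use homogeneous_kernel_continuous[OF assms] in auto)

section \<open>Local smallness of Riesz potentials\<close>

text \<open>
  The Riesz potential of order $k$ of the part of $P$ near $x$ is small, uniformly for $x$ in $A$ (a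
  condition of Kato type). This is the only form in which the integrability of the density enters
  the differentiation argument. The division convention $1/0 = 0$ gives the point $z = x$ no weight
  for $k \<ge> 1$ but full weight for $k = 0$.
\<close>
definition riesz_small :: "(real ^ 'n::finite) measure \<Rightarrow> nat \<Rightarrow> (real ^ 'n) set \<Rightarrow> bool" where
  "riesz_small P k A \<longleftrightarrow> (\<forall>e>0. \<exists>\<delta>>0. \<forall>x\<in>A.
     (\<integral>\<^sup>+z. ennreal (1 / norm (x - z) ^ k) * indicator (ball x \<delta>) z \<partial>P) \<le> ennreal e)"

text \<open>
  On a ball of radius at most $1$ the lower power is dominated by the higher one, except at the centre,
  where the convention $1/0 = 0$ spoils the comparison; hence the centre must not be an atom.
\<close>
lemma riesz_small_mono:
  assumes "riesz_small P l A" "k \<le> l" and null: "\<And>x. x \<in> A \<Longrightarrow> {x} \<in> null_sets P"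
  shows "riesz_small P k A"
  unfolding riesz_small_def
proof (intro allI impI)
  fix e :: real assume "e > 0"
  then obtain \<delta> where \<delta>: "\<delta> > 0"
    "\<And>x. x \<in> A \<Longrightarrow> (\<integral>\<^sup>+z. ennreal (1 / norm (x - z) ^ l) * indicator (ball x \<delta>) z \<partial>P) \<le> ennreal e"
    using assms(1) unfolding riesz_small_def by blast
  have "(\<integral>\<^sup>+z. ennreal (1 / norm (x - z) ^ k) * indicator (ball x (min \<delta> 1)) z \<partial>P) \<le> ennreal e"
    if x: "x \<in> A" for x
  proof -
    have "AE z in P. z \<noteq> x" using AE_not_in[OF null[OF x]] by simp
    then have "(\<integral>\<^sup>+z. ennreal (1 / norm (x - z) ^ k) * indicator (ball x (min \<delta> 1)) z \<partial>P)
      \<le> (\<integral>\<^sup>+z. ennreal (1 / norm (x - z) ^ l) * indicator (ball x \<delta>) z \<partial>P)"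
    proof (intro nn_integral_mono_AE, eventually_elim)
      case (elim z)
      show ?case
      proof (cases "z \<in> ball x (min \<delta> 1)")
        case True
        then have "norm (x - z) ^ l \<le> norm (x - z) ^ k"
          using assms(2) by (intro power_decreasing) (auto simp: dist_norm)
        then have "1 / norm (x - z) ^ k \<le> 1 / norm (x - z) ^ l"
          using elim by (intro divide_left_mono mult_pos_pos) auto
        then show ?thesis using True by (auto intro: ennreal_leI)
      qed auto
    qed
    also have "\<dots> \<le> ennreal e" by (rule \<delta>(2)[OF x])
    finally show ?thesis .
  qed
  then show "\<exists>\<delta>>0. \<forall>x\<in>A. (\<integral>\<^sup>+z. ennreal (1 / norm (x - z) ^ k) * indicator (ball x \<delta>) z \<partial>P) \<le> ennreal e"
    using \<delta>(1) by (intro exI[of _ "min \<delta> 1"]) auto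
qed

lemma ex_dyadic_shell:
  fixes u :: real
  assumes "0 < u" "u < \<delta>"
  obtains j where "\<delta> / 2 ^ Suc j \<le> u" "u < \<delta> / 2 ^ j"
proof -
  have "0 < u / \<delta>" using assms by simp
  then obtain n where n: "(1 / 2) ^ n < u / \<delta>"
    using real_arch_pow_inv[of "u / \<delta>" "1 / 2"] by auto
  have "\<delta> / 2 ^ n = \<delta> * (1 / 2) ^ n" by (simp add: power_one_over)
  also have "\<dots> \<le> \<delta> * (u / \<delta>)" using n assms by (intro mult_left_mono) auto
  finally have "\<delta> / 2 ^ n \<le> u" using assms by simp
  moreover have "\<not> \<delta> / 2 ^ 0 \<le> u" using assms by simp
  ultimately obtain j where "\<not> \<delta> / 2 ^ j \<le> u" "\<delta> / 2 ^ Suc j \<le> u"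
    using ex_least_nat_less[of "\<lambda>n. \<delta> / 2 ^ n \<le> u" n] by blast
  then show ?thesis using that[of j] by linarith
qed

text \<open>
  Cut the ball into the dyadic shells $\<delta>/2^{j+1} \<le> |x-z| < \<delta>/2^j$. On the $j$-th shell the integrand is
  at most $(\<delta>/2^{j+1})^{-s}$ and the volume is at most that of the surrounding ball, of order
  $(\<delta>/2^j)^d$. The products form a geometric series of ratio $2^{s-d} < 1$ and leading term of order
  $\<delta>^{d-s}$. Every ball is estimated around its own centre, which gives uniformity in $x$ at once.
\<close>
lemma riesz_potential_lborel_bound:
  fixes s :: real
  assumes "0 \<le> s" "s < DIM('a::euclidean_space)"
  obtains B where "B \<ge> 0" "\<And>(x::'a) \<delta>. \<delta> > 0 \<Longrightarrow>
    (\<integral>\<^sup>+z. ennreal (norm (x - z) powr (- s)) * indicator (ball x \<delta>) z \<partial>lborel)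
      \<le> ennreal (B * \<delta> powr (DIM('a) - s))"
proof -
  let ?d = "DIM('a)"
  define V where "V = unit_ball_vol (real ?d)"
  define q where "q = 2 powr (s - ?d)"
  define B where "B = V * 2 powr s * (1 / (1 - q))"
  have V: "V \<ge> 0" unfolding V_def by simp
  have q: "0 \<le> q" "q < 1" using assms(2) powr_less_one[of 2 "s - ?d"] by (auto simp: q_def)
  have "B \<ge> 0" using V q by (auto simp: B_def)
  moreover have "(\<integral>\<^sup>+z. ennreal (norm (x - z) powr (- s)) * indicator (ball x \<delta>) z \<partial>lborel)
      \<le> ennreal (B * \<delta> powr (?d - s))" if \<delta>: "\<delta> > 0" for x :: 'a and \<delta>
  proof -
    define c where "c j = (\<delta> / 2 ^ Suc j) powr (- s)" for j :: nat
    have c_nn: "0 \<le> c j" for j by (simp add: c_def)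
    have "(\<integral>\<^sup>+z. ennreal (norm (x - z) powr (- s)) * indicator (ball x \<delta>) z \<partial>lborel)
        \<le> (\<integral>\<^sup>+z. (\<Sum>j. ennreal (c j) * indicator (ball x (\<delta> / 2 ^ j)) z) \<partial>lborel)"
    proof (rule nn_integral_mono)
      fix z
      show "ennreal (norm (x - z) powr (- s)) * indicator (ball x \<delta>) z
         \<le> (\<Sum>j. ennreal (c j) * indicator (ball x (\<delta> / 2 ^ j)) z)"
      proof (cases "z \<in> ball x \<delta> \<and> z \<noteq> x")
        case True
        then obtain j where j: "\<delta> / 2 ^ Suc j \<le> norm (x - z)" "norm (x - z) < \<delta> / 2 ^ j"
          using ex_dyadic_shell[of "norm (x - z)" \<delta>] by (auto simp: dist_norm)
        have "norm (x - z) powr (- s) \<le> c j"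
          unfolding c_def using \<delta> j(1) assms(1) by (intro powr_mono2') auto
        then have "ennreal (norm (x - z) powr (- s)) * indicator (ball x \<delta>) z
          \<le> ennreal (c j) * indicator (ball x (\<delta> / 2 ^ j)) z"
          using True j(2) by (auto simp: dist_norm ennreal_leI)
        also have "\<dots> \<le> (\<Sum>j. ennreal (c j) * indicator (ball x (\<delta> / 2 ^ j)) z)"
          using sum_le_suminf[of "\<lambda>j. ennreal (c j) * indicator (ball x (\<delta> / 2 ^ j)) z" "{j}"]
          by (simp del: sum_mult_indicator sum_indicator_mult)
        finally show ?thesis .
      qed auto
    qed
    also have "\<dots> = (\<Sum>j. ennreal (c j) * ennreal (V * (\<delta> / 2 ^ j) ^ ?d))"
    proof -
      have "(\<integral>\<^sup>+z. ennreal (c j) * indicator (ball x (\<delta> / 2 ^ j)) z \<partial>lborel)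
          = ennreal (c j) * ennreal (V * (\<delta> / 2 ^ j) ^ ?d)" for j
        using \<delta> by (subst nn_integral_cmult_indicator) (auto simp: emeasure_ball V_def)
      moreover have "(\<lambda>z. ennreal (c j) * indicator (ball x (\<delta> / 2 ^ j)) z) \<in> borel_measurable lborel" for j
        by (intro borel_measurable_times_ennreal borel_measurable_const borel_measurable_indicator) simp
      ultimately show ?thesis by (simp add: nn_integral_suminf)
    qed
    also have "\<dots> = (\<Sum>j. ennreal (V * 2 powr s * \<delta> powr (?d - s) * q ^ j))"
    proof -
      have "c j * (V * (\<delta> / 2 ^ j) ^ ?d) = V * 2 powr s * \<delta> powr (?d - s) * q ^ j" for j
      proof -
        have e: "(\<delta> / 2 ^ j) ^ ?d = \<delta> powr ?d * 2 powr (- (real j * ?d))"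
        proof -
          have "(\<delta> / 2 ^ j) ^ ?d = \<delta> ^ ?d / 2 ^ (j * ?d)"
            by (simp add: power_divide power_mult)
          then show ?thesis
            using \<delta> by (simp add: powr_realpow powr_minus_divide flip: of_nat_mult)
        qed
        have c: "c j = \<delta> powr (- s) * 2 powr (s * (1 + real j))"
        proof -
          have two: "(2::real) ^ Suc j = 2 powr (1 + real j)"
            by (simp add: powr_realpow powr_add)
          show ?thesis
            unfolding c_def two using \<delta> by (simp add: powr_divide powr_powr powr_minus_divide mult.commute)
        qed
        have q: "q ^ j = 2 powr ((s - ?d) * j)"
          unfolding q_def by (simp add: powr_realpow[symmetric] powr_powr)
        have two: "2 powr (s * (1 + real j)) * 2 powr (- (real j * ?d)) = 2 powr s * 2 powr ((s - ?d) * j)"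
          by (subst (1 2) powr_add[symmetric]) (simp add: algebra_simps)
        have del: "\<delta> powr (- s) * \<delta> powr ?d = \<delta> powr (?d - s)"
          by (subst powr_add[symmetric]) simp
        have "c j * (V * (\<delta> / 2 ^ j) ^ ?d) = V * (2 powr (s * (1 + real j)) * 2 powr (- (real j * ?d)))
            * (\<delta> powr (- s) * \<delta> powr ?d)"
          unfolding e c by (simp only: mult_ac)
        then show ?thesis unfolding two del q by (simp only: mult_ac)
      qed
      then show ?thesis using c_nn by (simp only: ennreal_mult'[symmetric])
    qed
    also have "\<dots> = ennreal (\<Sum>j. V * 2 powr s * \<delta> powr (?d - s) * q ^ j)"
      using V q by (intro suminf_ennreal2 summable_mult summable_geometric mult_nonneg_nonneg) auto
    also have "\<dots> = ennreal (B * \<delta> powr (?d - s))"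
    proof -
      have "(\<Sum>j. V * 2 powr s * \<delta> powr (?d - s) * q ^ j) = V * 2 powr s * \<delta> powr (?d - s) * (\<Sum>j. q ^ j)"
        using q by (intro suminf_mult summable_geometric) auto
      also have "(\<Sum>j. q ^ j) = 1 / (1 - q)" using q by (intro suminf_geometric) auto
      finally show ?thesis by (simp add: B_def)
    qed
    finally show ?thesis .
  qed
  ultimately show ?thesis by (rule that)
qed

text \<open>
  The density is signed a priori and only Lebesgue measurable, so it is replaced by a Borel version
  $\<phi>$ of $|f|$ on $S$. The measure $P$ restricted to $S$ is then below the measure with density $\<phi>$, and
  this comparison of measures extends to integrals. An inequality suffices, as everything below is an
  upper bound.
\<close>
lemma nn_integral_le_density_over:
  fixes f :: "'a::euclidean_space \<Rightarrow> real"
  assumes P: "prob_space P" "sets P = sets borel" and dens: "has_density_over P f \<Omega>"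
    and S: "S \<in> sets borel" "S \<subseteq> \<Omega>" and g: "g \<in> borel_measurable borel"
  shows "(\<integral>\<^sup>+z. g z * indicator S z \<partial>P) \<le> (\<integral>\<^sup>+z. g z * ennreal \<bar>f z\<bar> * indicator S z \<partial>lebesgue)"
proof -
  interpret P: prob_space P by fact
  have [measurable_cong]: "sets P = sets borel" by fact
  have [measurable]: "S \<in> sets borel" "g \<in> borel_measurable borel" by fact+
  have intE: "set_integrable lebesgue E f" if "E \<in> sets borel" "E \<subseteq> \<Omega>" for E
  proof (rule set_integrable_subset)
    show "set_integrable lebesgue \<Omega> f" using dens by (simp add: has_density_over_def)
    show "E \<in> sets lebesgue" using that(1) by (simp add: sets_completionI_sets)
  qed (fact that(2))
  have fm: "(\<lambda>z. ennreal \<bar>indicator S z *\<^sub>R f z\<bar>) \<in> borel_measurable (completion lborel)"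
    using intE[OF S] unfolding set_integrable_def by auto
  obtain \<phi> where [measurable]: "\<phi> \<in> borel_measurable lborel"
    and \<phi>: "AE z in lborel. ennreal \<bar>indicator S z *\<^sub>R f z\<bar> = \<phi> z"
    using completion_ex_borel_measurable[OF fm] by auto
  have \<phi>': "AE z in lebesgue. ennreal \<bar>indicator S z *\<^sub>R f z\<bar> = \<phi> z"
    using \<phi> by (rule AE_completion)
  have "density P (indicator S) \<le> density lborel \<phi>"
  proof (subst le_measure; safe?)
    fix E assume "E \<in> sets (density P (indicator S))"
    then have [measurable]: "E \<in> sets borel" using P by simp
    have ES: "E \<inter> S \<in> sets borel" "E \<inter> S \<subseteq> \<Omega>" using S by auto
    have "emeasure (density P (indicator S)) E = emeasure P (E \<inter> S)"
      by (subst emeasure_density) (auto simp: indicator_inter_arith[symmetric] P Int_commute)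
    also have "\<dots> = ennreal (LINT z:E \<inter> S|lebesgue. f z)"
      using dens ES unfolding has_density_over_def by (simp add: P.emeasure_eq_measure)
    also have "\<dots> \<le> ennreal (LINT z:E \<inter> S|lebesgue. \<bar>f z\<bar>)"
      unfolding set_lebesgue_integral_def
      using intE[OF ES] by (intro ennreal_leI integral_mono)
         (auto simp: set_integrable_def abs_mult dest: integrable_abs split: split_indicator)
    also have "\<dots> = (\<integral>\<^sup>+z. ennreal (indicator (E \<inter> S) z *\<^sub>R \<bar>f z\<bar>) \<partial>lebesgue)"
      unfolding set_lebesgue_integral_def
      using integrable_abs[OF intE[OF ES, unfolded set_integrable_def]]
      by (intro nn_integral_eq_integral[symmetric]) (auto simp: abs_mult)
    also have "\<dots> = (\<integral>\<^sup>+z. \<phi> z * indicator E z \<partial>lebesgue)"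
      using \<phi>' by (intro nn_integral_cong_AE) (auto elim!: eventually_mono split: split_indicator)
    also have "\<dots> = emeasure (density lborel \<phi>) E"
      by (subst emeasure_density) (auto simp: nn_integral_completion)
    finally show "emeasure (density P (indicator S)) E \<le> emeasure (density lborel \<phi>) E" .
  qed (auto simp: P)
  then have "(\<integral>\<^sup>+z. g z \<partial>density P (indicator S)) \<le> (\<integral>\<^sup>+z. g z \<partial>density lborel \<phi>)"
    by (intro nn_integral_mono_measure) (auto simp: P)
  also have "(\<integral>\<^sup>+z. g z \<partial>density P (indicator S)) = (\<integral>\<^sup>+z. g z * indicator S z \<partial>P)"
    by (subst nn_integral_density) (auto simp: mult.commute)
  also have "(\<integral>\<^sup>+z. g z \<partial>density lborel \<phi>) = (\<integral>\<^sup>+z. \<phi> z * g z \<partial>lebesgue)"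
    by (subst nn_integral_density) (auto simp: nn_integral_completion)
  also have "\<dots> = (\<integral>\<^sup>+z. g z * ennreal \<bar>f z\<bar> * indicator S z \<partial>lebesgue)"
    using \<phi>' by (intro nn_integral_cong_AE)
      (auto elim!: eventually_mono simp: mult.commute split: split_indicator)
  finally show ?thesis .
qed

lemma null_sets_density_over:
  fixes f :: "'a::euclidean_space \<Rightarrow> real"
  assumes P: "prob_space P" "sets P = sets borel" and dens: "has_density_over P f \<Omega>"
    and N: "N \<in> null_sets lborel" "N \<subseteq> \<Omega>"
  shows "N \<in> null_sets P"
proof -
  have [measurable]: "N \<in> sets borel" using N by auto
  have "emeasure P N = (\<integral>\<^sup>+z. 1 * indicator N z \<partial>P)" using P by simp
  also have "\<dots> \<le> (\<integral>\<^sup>+z. 1 * ennreal \<bar>f z\<bar> * indicator N z \<partial>lebesgue)"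
    by (rule nn_integral_le_density_over[OF P dens]) (use N in auto)
  also have "\<dots> = 0"
  proof -
    have "AE z in lebesgue. z \<notin> N" using N AE_not_in[of N lborel] AE_completion by blast
    then have "(\<integral>\<^sup>+z. 1 * ennreal \<bar>f z\<bar> * indicator N z \<partial>lebesgue) = (\<integral>\<^sup>+z. 0 \<partial>lebesgue)"
      by (subst nn_integral_cong_AE[where v="\<lambda>z. 0"]) (auto elim!: eventually_mono)
    then show ?thesis by simp
  qed
  finally show ?thesis using P by (auto simp: null_sets_def)
qed

text \<open>
  A substitute for the inequalities of Young and Hoelder: compare $b$ with $\<mu> a^{p-1}$. If $b$ is smaller,
  the first term wins; if it is larger, then $a$ is bounded by a power of $b$ and the second term wins.
  Taking $\<mu>$ small makes the coefficient of $a^p$ as small as desired.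
\<close>
lemma mult_le_powr_split:
  fixes a b p \<mu> :: real
  assumes "0 \<le> a" "0 \<le> b" "p > 1" "\<mu> > 0"
  shows "a * b \<le> \<mu> * a powr p + \<mu> powr (- 1 / (p - 1)) * b powr (p / (p - 1))"
proof -
  have nn: "0 \<le> \<mu> * a powr p" "0 \<le> \<mu> powr (- 1 / (p - 1)) * b powr (p / (p - 1))"
      "0 \<le> \<mu> * a powr (p - 1)"
    using assms by auto
  show ?thesis
  proof (cases "b \<le> \<mu> * a powr (p - 1)")
    case True
    have "a * b \<le> a * (\<mu> * a powr (p - 1))" using True assms by (intro mult_left_mono)
    also have "\<dots> = \<mu> * a powr p" using assms by (cases "a = 0") (simp_all add: powr_diff)
    finally show ?thesis using nn by linarith
  next
    case False
    then have b: "b > 0" "a powr (p - 1) < b / \<mu>"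
      using nn(3) assms(4) by (linarith, simp add: pos_less_divide_eq mult.commute)
    have "a = (a powr (p - 1)) powr (1 / (p - 1))" using assms by (simp add: powr_powr)
    also have "\<dots> \<le> (b / \<mu>) powr (1 / (p - 1))" using b assms by (intro powr_mono2) auto
    also have "\<dots> = \<mu> powr (- 1 / (p - 1)) * b powr (1 / (p - 1))"
      by (simp add: powr_divide powr_minus_divide flip: minus_divide_left)
    finally have "a * b \<le> \<mu> powr (- 1 / (p - 1)) * b powr (1 / (p - 1)) * b"
      using b by (intro mult_right_mono) auto
    also have "\<dots> = \<mu> powr (- 1 / (p - 1)) * b powr (p / (p - 1))"
    proof -
      have "p / (p - 1) = 1 / (p - 1) + 1" using assms by (simp add: field_simps)
      then have "b powr (p / (p - 1)) = b powr (1 / (p - 1)) * b"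
        using b by (simp only: powr_add powr_one)
      then show ?thesis by (simp only: mult.assoc)
    qed
    finally show ?thesis using nn by linarith
  qed
qed

text \<open>
  The case $p = \<infinity>$ reduces to finite exponents: a bounded integrable function lies in $L^r$ for
  every finite $r \<ge> 1$. The exponent $r = c + 1$ is taken, and $|f|^{c+1} \<le> C^c |f|$ gives integrability.
\<close>
lemma Lp_on_finite_exponent:
  fixes f :: "'a::euclidean_space \<Rightarrow> real" and c :: real
  assumes Lp: "Lp_on p K f" and int: "set_integrable lebesgue K f"
    and c: "ennreal c < p" "c \<ge> 1"
  obtains r where "r > c" "set_integrable lebesgue K (\<lambda>z. \<bar>f z\<bar> powr r)"
proof (cases "p = \<infinity>")
  case False
  have "enn2real p > c"
    using c False by (metis ennreal_enn2real ennreal_less_iff infinity_ennreal_def less_top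
        linorder_not_less order_trans zero_le_one)
  then show ?thesis using that[of "enn2real p"] Lp False unfolding Lp_on_def by auto
next
  case True
  then obtain C where C: "AE x in lebesgue. x \<in> K \<longrightarrow> \<bar>f x\<bar> \<le> C"
    using Lp unfolding Lp_on_def by auto
  have [measurable]: "(\<lambda>z. indicator K z *\<^sub>R f z) \<in> borel_measurable lebesgue"
    using int unfolding set_integrable_def by auto
  have "set_integrable lebesgue K (\<lambda>z. \<bar>f z\<bar> powr (c + 1))"
    unfolding set_integrable_def
  proof (rule Bochner_Integration.integrable_bound)
    show "integrable lebesgue (\<lambda>z. C powr c * (indicator K z *\<^sub>R f z))"
      using int unfolding set_integrable_def by (intro integrable_mult_right)
    have "(\<lambda>z. \<bar>indicator K z *\<^sub>R f z\<bar> powr (c + 1)) \<in> borel_measurable lebesgue"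
      by measurable
    also have "(\<lambda>z. \<bar>indicator K z *\<^sub>R f z\<bar> powr (c + 1)) = (\<lambda>z. indicator K z *\<^sub>R \<bar>f z\<bar> powr (c + 1))"
      by (auto split: split_indicator)
    finally show "(\<lambda>z. indicator K z *\<^sub>R \<bar>f z\<bar> powr (c + 1)) \<in> borel_measurable lebesgue" .
    show "AE z in lebesgue. norm (indicator K z *\<^sub>R \<bar>f z\<bar> powr (c + 1)) \<le> norm (C powr c * (indicator K z *\<^sub>R f z))"
      using C
    proof eventually_elim
      case (elim z)
      have "\<bar>f z\<bar> powr (c + 1) \<le> C powr c * \<bar>f z\<bar>" if "z \<in> K"
        using elim that c powr_mono2[of c "\<bar>f z\<bar>" C] by (auto simp: powr_add intro!: mult_right_mono)
      then show ?case by (auto simp: abs_mult split: split_indicator)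
    qed
  qed
  then show ?thesis using that[of "c + 1"] by auto
qed

text \<open>
  The splitting of $a b$ with $a = |f(z)|$ and $b = |x-z|^{-l}$ bounds the potential by
  $\<mu> \<integral>|f|^r + D \<integral>|x-z|^{-s}$ with $s = l r/(r-1)$. Here $D$ depends on $\<mu>$, and the condition
  $r > d/(d-l)$ is exactly $s < d$, so the second integral over a ball of radius $\<delta>$ is of order
  $\<delta>^{d-s}$, uniformly in the centre. First $\<mu>$ and then $\<delta>$ is chosen small.
\<close>
lemma riesz_small_of_Lp:
  fixes f :: "real ^ 'n::finite \<Rightarrow> real"
  assumes P: "prob_space P" "sets P = sets borel" and dens: "has_density_over P f \<Omega>"
    and l: "1 \<le> l" "l < CARD('n)"
    and p: "p > ennreal (real CARD('n) / (real CARD('n) - real l))"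
    and Lp: "Lp_on p K f" and K: "closed K" "K \<subseteq> \<Omega>"
    and A: "\<rho> > 0" "\<And>x. x \<in> A \<Longrightarrow> ball x \<rho> \<subseteq> K"
  shows "riesz_small P l A"
proof -
  let ?d = "CARD('n)"
  have Kl[measurable]: "K \<in> sets borel" "K \<in> sets lebesgue" using K by auto
  have intK: "set_integrable lebesgue K f"
    using dens Kl(2) K(2) unfolding has_density_over_def by (blast intro: set_integrable_subset)
  have c: "real ?d / (real ?d - real l) > 1" using l by (simp add: field_simps)
  obtain r where r: "r > real ?d / (real ?d - real l)" "set_integrable lebesgue K (\<lambda>z. \<bar>f z\<bar> powr r)"
    by (rule Lp_on_finite_exponent[OF Lp intK p]) (use c in auto)
  have r1: "r > 1" using r c by simp
  define s where "s = real l * (r / (r - 1))"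
  have s: "0 \<le> s" "s < ?d"
  proof -
    have "r * real l < (r - 1) * ?d" using r(1) l by (simp add: field_simps)
    then show "s < ?d" using r1 by (simp add: s_def field_simps)
    show "0 \<le> s" using r1 by (simp add: s_def)
  qed
  define N where "N = (LINT z:K|lebesgue. \<bar>f z\<bar> powr r)"
  have N: "(\<integral>\<^sup>+z. ennreal (\<bar>f z\<bar> powr r) * indicator K z \<partial>lebesgue) = ennreal N" "N \<ge> 0"
  proof -
    have "(\<integral>\<^sup>+z. ennreal (indicator K z *\<^sub>R \<bar>f z\<bar> powr r) \<partial>lebesgue) = ennreal N"
      using r(2) unfolding N_def set_lebesgue_integral_def set_integrable_def
      by (intro nn_integral_eq_integral) auto
    also have "(\<integral>\<^sup>+z. ennreal (indicator K z *\<^sub>R \<bar>f z\<bar> powr r) \<partial>lebesgue)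
        = (\<integral>\<^sup>+z. ennreal (\<bar>f z\<bar> powr r) * indicator K z \<partial>lebesgue)"
      by (intro nn_integral_cong) (auto split: split_indicator)
    finally show "(\<integral>\<^sup>+z. ennreal (\<bar>f z\<bar> powr r) * indicator K z \<partial>lebesgue) = ennreal N" .
    show "N \<ge> 0" unfolding N_def set_lebesgue_integral_def by (intro Bochner_Integration.integral_nonneg) auto
  qed
  have fr[measurable]: "(\<lambda>z. ennreal (\<bar>f z\<bar> powr r) * indicator K z) \<in> borel_measurable lebesgue"
  proof -
    have "(\<lambda>z. ennreal (indicator K z *\<^sub>R \<bar>f z\<bar> powr r)) \<in> borel_measurable lebesgue"
      using r(2) unfolding set_integrable_def by auto
    also have "(\<lambda>z. ennreal (indicator K z *\<^sub>R \<bar>f z\<bar> powr r)) = (\<lambda>z. ennreal (\<bar>f z\<bar> powr r) * indicator K z)"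
      by (auto split: split_indicator)
    finally show ?thesis .
  qed
  obtain B where B: "B \<ge> 0" "\<And>(x::real^'n) \<delta>. \<delta> > 0 \<Longrightarrow>
    (\<integral>\<^sup>+z. ennreal (norm (x - z) powr (- s)) * indicator (ball x \<delta>) z \<partial>lborel)
      \<le> ennreal (B * \<delta> powr (?d - s))"
    using riesz_potential_lborel_bound[of s, where 'a="real^'n"] s by auto
  show ?thesis unfolding riesz_small_def
  proof (intro allI impI)
    fix e :: real assume e: "e > 0"
    \<comment> \<open>half of the budget is for the first integral; the summand 1 avoids a division by zero\<close>
    define \<mu> where "\<mu> = e / (2 * (N + 1))"
    have \<mu>: "\<mu> > 0" "\<mu> * N \<le> e / 2" using e N(2) by (auto simp: \<mu>_def field_simps)
    define D where "D = \<mu> powr (- 1 / (r - 1))"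
    have "((\<lambda>\<delta>. D * (B * \<delta> powr (?d - s))) \<longlongrightarrow> D * (B * 0 powr (?d - s))) (at_right 0)"
      using s by (intro tendsto_intros tendsto_powr') (auto simp: eventually_at_filter)
    then have "eventually (\<lambda>\<delta>. D * (B * \<delta> powr (?d - s)) < e / 2) (at_right 0)"
      using e by (intro order_tendstoD(2)) auto
    moreover have "eventually (\<lambda>\<delta>. \<delta> < \<rho>) (at_right 0)" "eventually (\<lambda>\<delta>::real. \<delta> > 0) (at_right 0)"
      using A(1) by (auto intro: eventually_at_right_less eventually_at_rightI)
    ultimately have "eventually (\<lambda>\<delta>. D * (B * \<delta> powr (?d - s)) < e / 2 \<and> \<delta> < \<rho> \<and> \<delta> > 0) (at_right 0)"
      by eventually_elim auto
    then obtain \<delta> where \<delta>: "D * (B * \<delta> powr (?d - s)) < e / 2" "\<delta> < \<rho>" "\<delta> > 0"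
      using eventually_happens[of _ "at_right (0::real)"] by auto
    have "(\<integral>\<^sup>+z. ennreal (1 / norm (x - z) ^ l) * indicator (ball x \<delta>) z \<partial>P) \<le> ennreal e"
      if x: "x \<in> A" for x
    proof -
      have bK: "ball x \<delta> \<subseteq> K" using A(2)[OF x] \<delta> by (auto simp: subset_iff)
      have "(\<integral>\<^sup>+z. ennreal (1 / norm (x - z) ^ l) * indicator (ball x \<delta>) z \<partial>P)
        \<le> (\<integral>\<^sup>+z. ennreal (1 / norm (x - z) ^ l) * ennreal \<bar>f z\<bar> * indicator (ball x \<delta>) z \<partial>lebesgue)"
        by (rule nn_integral_le_density_over[OF P dens]) (use bK K in auto)
      also have "\<dots> \<le> (\<integral>\<^sup>+z. ennreal \<mu> * (ennreal (\<bar>f z\<bar> powr r) * indicator K z)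
          + ennreal D * (ennreal (norm (x - z) powr (- s)) * indicator (ball x \<delta>) z) \<partial>lebesgue)"
      proof (rule nn_integral_mono)
        fix z
        have eq: "(1 / norm (x - z) ^ l) powr (r / (r - 1)) = norm (x - z) powr (- s)"
        proof (cases "x = z")
          case False
          then have "1 / norm (x - z) ^ l = norm (x - z) powr (- real l)"
            by (simp add: powr_minus_divide powr_realpow)
          then show ?thesis by (simp add: s_def powr_powr)
        qed (use l in auto)
        have "1 / norm (x - z) ^ l * \<bar>f z\<bar> \<le> \<mu> * \<bar>f z\<bar> powr r + D * norm (x - z) powr (- s)"
          using mult_le_powr_split[of "\<bar>f z\<bar>" "1 / norm (x - z) ^ l" r \<mu>] r1 \<mu> eq
          by (simp add: D_def mult.commute)
        then have "ennreal (1 / norm (x - z) ^ l * \<bar>f z\<bar>) \<le> ennreal (\<mu> * \<bar>f z\<bar> powr r + D * norm (x - z) powr (- s))"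
          by (rule ennreal_leI)
        also have "\<dots> = ennreal \<mu> * ennreal (\<bar>f z\<bar> powr r) + ennreal D * ennreal (norm (x - z) powr (- s))"
        proof -
          have nn: "0 \<le> \<mu>" "0 \<le> D" "0 \<le> \<mu> * \<bar>f z\<bar> powr r" "0 \<le> D * norm (x - z) powr (- s)"
            using \<mu>(1) by (simp_all add: D_def)
          show ?thesis by (simp only: ennreal_mult'[OF nn(1)] ennreal_mult'[OF nn(2)] ennreal_plus[OF nn(3,4)])
        qed
        finally show "ennreal (1 / norm (x - z) ^ l) * ennreal \<bar>f z\<bar> * indicator (ball x \<delta>) z \<le> ennreal \<mu> * (ennreal (\<bar>f z\<bar> powr r) * indicator K z)
          + ennreal D * (ennreal (norm (x - z) powr (- s)) * indicator (ball x \<delta>) z)"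
          using bK by (cases "z \<in> ball x \<delta>") (auto simp: ennreal_mult'[symmetric])
      qed
      also have "\<dots> = ennreal \<mu> * (\<integral>\<^sup>+z. ennreal (\<bar>f z\<bar> powr r) * indicator K z \<partial>lebesgue)
          + ennreal D * (\<integral>\<^sup>+z. ennreal (norm (x - z) powr (- s)) * indicator (ball x \<delta>) z \<partial>lebesgue)"
      proof -
        have [measurable]: "(\<lambda>z. ennreal (norm (x - z) powr (- s)) * indicator (ball x \<delta>) z) \<in> borel_measurable lebesgue"
        proof (intro measurable_completion borel_measurable_times_ennreal borel_measurable_indicator)
          show "(\<lambda>z. ennreal (norm (x - z) powr (- s))) \<in> borel_measurable lborel" by measurable
        qed simp
        show ?thesis by (simp add: nn_integral_add nn_integral_cmult)
      qed
      also have "\<dots> \<le> ennreal \<mu> * ennreal N + ennreal D * ennreal (B * \<delta> powr (?d - s))"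
        unfolding N(1) unfolding nn_integral_completion
        by (intro add_left_mono mult_left_mono B(2)[OF \<delta>(3)]) simp
      also have "\<dots> = ennreal (\<mu> * N + D * (B * \<delta> powr (?d - s)))"
      proof -
        have nn: "0 \<le> \<mu>" "0 \<le> D" "0 \<le> \<mu> * N" "0 \<le> D * (B * \<delta> powr (?d - s))"
          using \<mu>(1) N(2) B(1) by (simp_all add: D_def)
        show ?thesis by (simp only: ennreal_mult'[OF nn(1)] ennreal_mult'[OF nn(2)] ennreal_plus[OF nn(3,4)])
      qed
      also have "\<dots> \<le> ennreal e" using \<mu>(2) \<delta>(1) by (intro ennreal_leI) auto
      finally show ?thesis .
    qed
    then show "\<exists>\<delta>>0. \<forall>x\<in>A. (\<integral>\<^sup>+z. ennreal (1 / norm (x - z) ^ l) * indicator (ball x \<delta>) z \<partial>P) \<le> ennreal e"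
      using \<delta>(3) by blast
  qed
qed

section \<open>Convolution of a measure with a singular kernel\<close>

definition conv :: "(real ^ 'n::finite \<Rightarrow> real ^ 'n) \<Rightarrow> (real ^ 'n) measure \<Rightarrow> real ^ 'n \<Rightarrow> real ^ 'n" where
  "conv g P x = (LINT z|P. g (x - z))"

text \<open>
  A continuous profile that is 0 within distance $\<delta>/2$ of the origin and 1 beyond distance $\<delta>$.
  Multiplication by it removes the singularity of a kernel.
\<close>
definition cutoff :: "real \<Rightarrow> 'a::real_normed_vector \<Rightarrow> real" where
  "cutoff \<delta> y = min 1 (max 0 (2 * norm y / \<delta> - 1))"

lemma cutoff_range: "0 \<le> cutoff \<delta> y" "cutoff \<delta> y \<le> 1"
  by (auto simp: cutoff_def)

lemma cutoff_eq_0: "\<delta> > 0 \<Longrightarrow> norm y \<le> \<delta> / 2 \<Longrightarrow> cutoff \<delta> y = 0"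
  by (auto simp: cutoff_def field_simps)

lemma cutoff_eq_1: "\<delta> > 0 \<Longrightarrow> norm y \<ge> \<delta> \<Longrightarrow> cutoff \<delta> y = 1"
  by (auto simp: cutoff_def field_simps)

lemma cutoff_kernel_continuous:
  assumes "homogeneous_kernel k g" "\<delta> > 0"
  shows "continuous_on UNIV (\<lambda>y. cutoff \<delta> y *\<^sub>R g y)"
proof -
  have "continuous_on (ball 0 (\<delta> / 2)) (\<lambda>y. cutoff \<delta> y *\<^sub>R g y)"
  proof -
    have "cutoff \<delta> y *\<^sub>R g y = 0" if "y \<in> ball 0 (\<delta> / 2)" for y
      using that cutoff_eq_0[OF assms(2), of y] by simp
    then show ?thesis by (subst continuous_on_cong[where g="\<lambda>y. 0"]) (rule refl, assumption, rule continuous_on_const)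
  qed
  moreover have "continuous_on (- {0}) (\<lambda>y. cutoff \<delta> y *\<^sub>R g y)"
    unfolding cutoff_def using assms(2)
    by (intro continuous_intros homogeneous_kernel_continuous[OF assms(1)]) auto
  ultimately have "continuous_on (ball 0 (\<delta> / 2) \<union> - {0}) (\<lambda>y. cutoff \<delta> y *\<^sub>R g y)"
    by (intro continuous_on_open_Un) auto
  moreover have "ball 0 (\<delta> / 2) \<union> - {0} = (UNIV :: (real^'a) set)" using assms(2) by auto
  ultimately show ?thesis by simp
qed

lemma cutoff_kernel_bounded:
  assumes "homogeneous_kernel k g" "\<delta> > 0"
  obtains B where "\<And>y. norm (cutoff \<delta> y *\<^sub>R g y) \<le> B"
proof -
  obtain C where C: "C > 0" "\<And>y. y \<noteq> 0 \<Longrightarrow> norm (g y) \<le> C / norm y ^ k"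
    using homogeneous_kernel_bound[OF assms(1)] by blast
  have "norm (cutoff \<delta> y *\<^sub>R g y) \<le> C / (\<delta> / 2) ^ k" for y
  proof (cases "norm y \<le> \<delta> / 2")
    case True
    then show ?thesis using C assms(2) by (simp add: cutoff_eq_0)
  next
    case False
    then have y: "y \<noteq> 0" "\<delta> / 2 \<le> norm y" using assms(2) by auto
    have "norm (cutoff \<delta> y *\<^sub>R g y) \<le> 1 * norm (g y)"
      using cutoff_range[of \<delta> y] by (simp add: mult_left_le_one_le)
    also have "\<dots> \<le> C / norm y ^ k" using C(2)[OF y(1)] by simp
    also have "\<dots> \<le> C / (\<delta> / 2) ^ k"
      using C(1) y assms(2) by (intro divide_left_mono power_mono mult_pos_pos zero_less_power) auto
    finally show ?thesis .
  qed
  then show ?thesis by (rule that)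
qed

locale borel_prob = prob_space P for P :: "(real ^ 'n::finite) measure" +
  assumes sets_P [measurable_cong]: "sets P = sets borel"
begin

lemma integrable_bounded_conv:
  fixes h :: "real ^ 'n \<Rightarrow> real ^ 'n"
  assumes "h \<in> borel_measurable borel" "\<And>y. norm (h y) \<le> B"
  shows "integrable P (\<lambda>z. h (x - z))"
proof (rule integrable_const_bound)
  show "AE z in P. norm (h (x - z)) \<le> B" using assms(2) by simp
  show "(\<lambda>z. h (x - z)) \<in> borel_measurable P" using assms(1) by measurable
qed

lemma conv_bounded_continuous:
  assumes h: "continuous_on UNIV h" and B: "\<And>y. norm (h y) \<le> B"
  shows "continuous_on UNIV (conv h P)"
proof (rule continuous_at_imp_continuous_on, intro ballI)
  fix x :: "real ^ 'n"
  have [measurable]: "h \<in> borel_measurable borel" using h by (rule borel_measurable_continuous_onI)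
  have "(\<lambda>n. conv h P (X n)) \<longlonglongrightarrow> conv h P x" if X: "X \<longlonglongrightarrow> x" for X
    unfolding conv_def
  proof (rule integral_dominated_convergence[where w="\<lambda>z. B"])
    have "(\<lambda>n. h (X n - z)) \<longlonglongrightarrow> h (x - z)" for z
      by (rule continuous_on_tendsto_compose[OF h]) (auto intro!: tendsto_intros X)
    then show "AE z in P. (\<lambda>n. h (X n - z)) \<longlonglongrightarrow> h (x - z)" by simp
  qed (use B in auto)
  then show "isCont (conv h P) x"
    by (auto simp: continuous_at_sequentially o_def)
qed

text \<open>
  Dominated convergence along any sequence that tends to infinity. A sequence that violates the limit
  would contradict this.
\<close>
lemma conv_vanishes_at_infinity:
  assumes [measurable]: "h \<in> borel_measurable borel" and B: "\<And>y. norm (h y) \<le> B"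
    and lim: "(h \<longlongrightarrow> 0) at_infinity"
  shows "(conv h P \<longlongrightarrow> 0) at_infinity"
proof (rule tendstoI, rule ccontr)
  fix e :: real assume "e > 0" and ne: "\<not> eventually (\<lambda>x. dist (conv h P x) 0 < e) at_infinity"
  have "\<exists>x. norm x \<ge> real n \<and> \<not> dist (conv h P x) 0 < e" for n :: nat
    using ne unfolding eventually_at_infinity by blast
  then obtain X where X: "\<And>n::nat. norm (X n) \<ge> real n" "\<And>n. \<not> dist (conv h P (X n)) 0 < e"
    by metis
  have "(\<lambda>n. conv h P (X n)) \<longlonglongrightarrow> (LINT z|P. 0)"
    unfolding conv_def
  proof (rule integral_dominated_convergence[where w="\<lambda>z. B"])
    have "(\<lambda>n. h (X n - z)) \<longlonglongrightarrow> 0" for z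
    proof (rule filterlim_compose[OF lim])
      have "filterlim (\<lambda>n. norm (X n - z)) at_top sequentially"
      proof (rule filterlim_at_top_mono)
        show "filterlim (\<lambda>n. - norm z + real n) at_top sequentially"
          by (rule filterlim_tendsto_add_at_top[OF tendsto_const filterlim_real_sequentially])
        show "\<forall>\<^sub>F n in sequentially. - norm z + real n \<le> norm (X n - z)"
        proof (intro always_eventually allI)
          fix n show "- norm z + real n \<le> norm (X n - z)"
            using X(1)[of n] norm_triangle_ineq2[of "X n" z] by linarith
        qed
      qed
      then show "filterlim (\<lambda>n. X n - z) at_infinity sequentially"
        by (rule filterlim_norm_at_top_imp_at_infinity)
    qed
    then show "AE z in P. (\<lambda>n. h (X n - z)) \<longlonglongrightarrow> 0" by simp
  qed (use B in auto)
  then have "(\<lambda>n. conv h P (X n)) \<longlonglongrightarrow> 0" by simp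
  from tendstoD[OF this \<open>e > 0\<close>] show False
    using X(2) by (auto dest: eventually_happens)
qed

lemma riesz_integrand_measurable [measurable]:
  "(\<lambda>z. ennreal (1 / norm (x - z) ^ k) * indicator (ball x \<delta>) z) \<in> borel_measurable P"
proof -
  have "(\<lambda>z. ennreal (1 / norm (x - z) ^ k)) \<in> borel_measurable borel" by measurable
  then have "(\<lambda>z. ennreal (1 / norm (x - z) ^ k) * indicator (ball x \<delta>) z) \<in> borel_measurable borel"
    by (intro borel_measurable_times_ennreal borel_measurable_indicator) auto
  then show ?thesis by (simp cong: measurable_cong_sets add: sets_P)
qed

context
  fixes A :: "(real ^ 'n) set" and k :: nat and g :: "real ^ 'n \<Rightarrow> real ^ 'n"
  assumes small: "riesz_small P k A" and null: "\<And>x. x \<in> A \<Longrightarrow> {x} \<in> null_sets P"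
    and hom: "homogeneous_kernel k g"
begin

lemma kernel_measurable [measurable]: "g \<in> borel_measurable borel"
  by (rule homogeneous_kernel_measurable[OF hom])

text \<open>
  Inside a small ball the kernel is controlled by the Riesz potential, outside by $C/\<delta>^k$
  and the total mass 1.
\<close>
lemma conv_norm_bound:
  "\<exists>M\<ge>0. \<forall>x\<in>A. (\<integral>\<^sup>+z. ennreal (norm (g (x - z))) \<partial>P) \<le> ennreal M"
proof -
  obtain C where C: "C > 0" "\<And>y. y \<noteq> 0 \<Longrightarrow> norm (g y) \<le> C / norm y ^ k"
    using homogeneous_kernel_bound[OF hom] by blast
  obtain \<delta> where \<delta>: "\<delta> > 0"
    "\<And>x. x \<in> A \<Longrightarrow> (\<integral>\<^sup>+z. ennreal (1 / norm (x - z) ^ k) * indicator (ball x \<delta>) z \<partial>P) \<le> ennreal 1"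
    using small[unfolded riesz_small_def, rule_format, OF zero_less_one] by blast
  have "(\<integral>\<^sup>+z. ennreal (norm (g (x - z))) \<partial>P) \<le> ennreal (C + C / \<delta> ^ k)" if x: "x \<in> A" for x
  proof -
    have "AE z in P. z \<noteq> x" using AE_not_in[OF null[OF x]] by simp
    then have "(\<integral>\<^sup>+z. ennreal (norm (g (x - z))) \<partial>P)
       \<le> (\<integral>\<^sup>+z. ennreal C * (ennreal (1 / norm (x - z) ^ k) * indicator (ball x \<delta>) z) + ennreal (C / \<delta> ^ k) \<partial>P)"
    proof (intro nn_integral_mono_AE, eventually_elim)
      case (elim z)
      have le: "norm (g (x - z)) \<le> C / norm (x - z) ^ k" using C(2)[of "x - z"] elim by simp
      show ?case
      proof (cases "z \<in> ball x \<delta>")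
        case True
        have "ennreal (norm (g (x - z))) \<le> ennreal (C * (1 / norm (x - z) ^ k))"
          using le by (intro ennreal_leI) simp
        also have "\<dots> = ennreal C * (ennreal (1 / norm (x - z) ^ k) * indicator (ball x \<delta>) z)"
          using True C(1) by (simp only: ennreal_mult'[OF less_imp_le[OF C(1)]] indicator_simps mult_1_right)
        finally show ?thesis by (rule add_increasing2[rotated]) simp
      next
        case False
        have "C / norm (x - z) ^ k \<le> C / \<delta> ^ k"
          using False C(1) \<delta>(1) by (intro divide_left_mono power_mono mult_pos_pos zero_less_power)
             (auto simp: dist_norm)
        then have "ennreal (norm (g (x - z))) \<le> ennreal (C / \<delta> ^ k)"
          using le by (intro ennreal_leI) simp
        then show ?thesis using False by simp
      qed
    qed
    also have "\<dots> = ennreal C * (\<integral>\<^sup>+z. ennreal (1 / norm (x - z) ^ k) * indicator (ball x \<delta>) z \<partial>P) + ennreal (C / \<delta> ^ k)"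
      by (simp add: nn_integral_add nn_integral_cmult emeasure_space_1 riesz_integrand_measurable)
    also have "\<dots> \<le> ennreal C * ennreal 1 + ennreal (C / \<delta> ^ k)"
      by (intro add_right_mono mult_left_mono \<delta>(2)[OF x]) simp
    also have "\<dots> = ennreal (C + C / \<delta> ^ k)"
      using C(1) \<delta>(1) by (subst ennreal_plus) auto
    finally show ?thesis .
  qed
  then show ?thesis using C(1) \<delta>(1) by (intro exI[of _ "C + C / \<delta> ^ k"]) auto
qed

lemma conv_integrable:
  assumes "x \<in> A"
  shows "integrable P (\<lambda>z. g (x - z))"
proof (rule integrableI_bounded)
  obtain M where "(\<integral>\<^sup>+z. ennreal (norm (g (x - z))) \<partial>P) \<le> ennreal M"
    using conv_norm_bound assms by blast
  then show "(\<integral>\<^sup>+z. ennreal (norm (g (x - z))) \<partial>P) < \<infinity>"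
    by (metis ennreal_less_top infinity_ennreal_def order_le_less_trans)
qed measurable

text \<open>
  The truncation changes the convolution by at most a constant times the Riesz potential of the ball
  of radius $\<delta>$. Hence continuity and decay pass from truncated kernels to the singular one by
  uniform approximation.
\<close>
lemma cutoff_conv_approx:
  assumes "e > 0"
  obtains \<delta> where "\<delta> > 0" "\<And>x. x \<in> A \<Longrightarrow> norm (conv g P x - conv (\<lambda>y. cutoff \<delta> y *\<^sub>R g y) P x) \<le> e"
proof -
  obtain C where C: "C > 0" "\<And>y. y \<noteq> 0 \<Longrightarrow> norm (g y) \<le> C / norm y ^ k"
    using homogeneous_kernel_bound[OF hom] by blast
  have "e / C > 0" using assms C(1) by simp
  from small[unfolded riesz_small_def, rule_format, OF this] obtain \<delta> where \<delta>: "\<delta> > 0"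
    "\<And>x. x \<in> A \<Longrightarrow> (\<integral>\<^sup>+z. ennreal (1 / norm (x - z) ^ k) * indicator (ball x \<delta>) z \<partial>P) \<le> ennreal (e / C)"
    by blast
  let ?h = "\<lambda>y. cutoff \<delta> y *\<^sub>R g y"
  have hm: "?h \<in> borel_measurable borel"
    by (rule borel_measurable_continuous_onI[OF cutoff_kernel_continuous[OF hom \<delta>(1)]])
  obtain B where B: "\<And>y. norm (?h y) \<le> B" using cutoff_kernel_bounded[OF hom \<delta>(1)] by blast
  have "norm (conv g P x - conv ?h P x) \<le> e" if x: "x \<in> A" for x
  proof -
    note int = conv_integrable[OF x] integrable_bounded_conv[OF hm B, of x]
    have "ennreal (norm (conv g P x - conv ?h P x)) = ennreal (norm (LINT z|P. g (x - z) - ?h (x - z)))"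
      unfolding conv_def using int by simp
    also have "\<dots> \<le> (\<integral>\<^sup>+z. ennreal (norm (g (x - z) - ?h (x - z))) \<partial>P)"
      by (rule integral_norm_bound_ennreal) (intro Bochner_Integration.integrable_diff int)
    also have "\<dots> \<le> (\<integral>\<^sup>+z. ennreal C * (ennreal (1 / norm (x - z) ^ k) * indicator (ball x \<delta>) z) \<partial>P)"
    proof -
      have "AE z in P. z \<noteq> x" using AE_not_in[OF null[OF x]] by simp
      then show ?thesis
      proof (intro nn_integral_mono_AE, eventually_elim)
        case (elim z)
        show ?case
        proof (cases "z \<in> ball x \<delta>")
          case True
          have "g (x - z) - ?h (x - z) = (1 - cutoff \<delta> (x - z)) *\<^sub>R g (x - z)" by (simp add: scaleR_left_diff_distrib)
          then have "norm (g (x - z) - ?h (x - z)) \<le> 1 * norm (g (x - z))"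
            using cutoff_range[of \<delta> "x - z"] by (simp add: mult_left_le_one_le)
          also have "\<dots> \<le> C * (1 / norm (x - z) ^ k)" using C(2)[of "x - z"] elim by simp
          finally have "ennreal (norm (g (x - z) - ?h (x - z))) \<le> ennreal (C * (1 / norm (x - z) ^ k))"
            by (rule ennreal_leI)
          also have "\<dots> = ennreal C * (ennreal (1 / norm (x - z) ^ k) * indicator (ball x \<delta>) z)"
            using True C(1) by (simp only: ennreal_mult'[OF less_imp_le[OF C(1)]] indicator_simps mult_1_right)
          finally show ?thesis .
        next
          case False
          then show ?thesis using \<delta>(1) by (simp add: cutoff_eq_1 dist_norm)
        qed
      qed
    qed
    also have "\<dots> = ennreal C * (\<integral>\<^sup>+z. ennreal (1 / norm (x - z) ^ k) * indicator (ball x \<delta>) z \<partial>P)"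
      by (rule nn_integral_cmult[OF riesz_integrand_measurable])
    also have "\<dots> \<le> ennreal C * ennreal (e / C)" by (intro mult_left_mono \<delta>(2)[OF x]) simp
    also have "\<dots> = ennreal e" using C(1) by (simp flip: ennreal_mult')
    finally show ?thesis using assms by simp
  qed
  with \<delta>(1) show ?thesis by (rule that)
qed

lemma conv_continuous: "continuous_on A (conv g P)"
proof -
  have "\<exists>\<delta>>0. \<forall>x\<in>A. norm (conv g P x - conv (\<lambda>y. cutoff \<delta> y *\<^sub>R g y) P x) \<le> 1 / Suc n" for n
    using cutoff_conv_approx[of "1 / Suc n"] by (metis of_nat_0_less_iff zero_less_Suc zero_less_divide_1_iff)
  then obtain \<delta> where \<delta>: "\<And>n. \<delta> n > 0"
    "\<And>n x. x \<in> A \<Longrightarrow> norm (conv g P x - conv (\<lambda>y. cutoff (\<delta> n) y *\<^sub>R g y) P x) \<le> 1 / Suc n"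
    by metis
  show ?thesis
  proof (rule uniform_limit_theorem[of _ _ sequentially])
    show "\<forall>\<^sub>F n in sequentially. continuous_on A (conv (\<lambda>y. cutoff (\<delta> n) y *\<^sub>R g y) P)"
    proof (intro always_eventually allI)
      fix n
      obtain B where "\<And>y. norm (cutoff (\<delta> n) y *\<^sub>R g y) \<le> B"
        using cutoff_kernel_bounded[OF hom \<delta>(1)] by blast
      from conv_bounded_continuous[OF cutoff_kernel_continuous[OF hom \<delta>(1)] this]
      show "continuous_on A (conv (\<lambda>y. cutoff (\<delta> n) y *\<^sub>R g y) P)"
        by (rule continuous_on_subset) simp
    qed
    show "uniform_limit A (\<lambda>n. conv (\<lambda>y. cutoff (\<delta> n) y *\<^sub>R g y) P) (conv g P) sequentially"
    proof (rule uniform_limitI)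
      fix e :: real assume "e > 0"
      have "(\<lambda>n. 1 / real (Suc n)) \<longlonglongrightarrow> 0"
        by (rule LIMSEQ_Suc[OF lim_1_over_n])
      then have "\<forall>\<^sub>F n in sequentially. 1 / real (Suc n) < e"
        using \<open>e > 0\<close> by (rule order_tendstoD(2))
      then show "\<forall>\<^sub>F n in sequentially. \<forall>x\<in>A. dist (conv (\<lambda>y. cutoff (\<delta> n) y *\<^sub>R g y) P x) (conv g P x) < e"
      proof eventually_elim
        case (elim n)
        show ?case
        proof
          fix x assume "x \<in> A"
          from \<delta>(2)[OF this, of n] elim
          show "dist (conv (\<lambda>y. cutoff (\<delta> n) y *\<^sub>R g y) P x) (conv g P x) < e"
            by (simp only: dist_norm norm_minus_commute)
        qed
      qed
    qed
  qed simp
qed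

end

text \<open>
  Up to a uniformly small error the kernel may be truncated. The truncated kernel is bounded, and for
  $k \<ge> 1$ it vanishes at infinity. A kernel of degree $0$ need not vanish at infinity, and indeed the
  geometric cdf itself does not decay.
\<close>
lemma conv_tendsto_0_at_infinity:
  assumes small: "riesz_small P k UNIV" and null: "\<And>x. {x} \<in> null_sets P"
    and hom: "homogeneous_kernel k g" and k: "k \<ge> 1"
  shows "(conv g P \<longlongrightarrow> 0) at_infinity"
proof (rule tendstoI)
  fix e :: real assume e: "e > 0"
  obtain \<delta> where \<delta>: "\<delta> > 0" "\<And>x. norm (conv g P x - conv (\<lambda>y. cutoff \<delta> y *\<^sub>R g y) P x) \<le> e / 2"
    using cutoff_conv_approx[OF small null hom, of "e / 2"] e by auto
  let ?h = "\<lambda>y. cutoff \<delta> y *\<^sub>R g y"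
  obtain C where C: "C > 0" "\<And>y. y \<noteq> 0 \<Longrightarrow> norm (g y) \<le> C / norm y ^ k"
    using homogeneous_kernel_bound[OF hom] by blast
  obtain B where B: "\<And>y. norm (?h y) \<le> B" using cutoff_kernel_bounded[OF hom \<delta>(1)] by blast
  have "(?h \<longlongrightarrow> 0) at_infinity"
  proof (rule Lim_null_comparison)
    show "\<forall>\<^sub>F y in at_infinity. norm (?h y) \<le> C * inverse (norm y)"
      unfolding eventually_at_infinity
    proof (intro exI[of _ 1] allI impI)
      fix y :: "real ^ 'n" assume y: "1 \<le> norm y"
      then have "norm y ^ 1 \<le> norm y ^ k" using k by (intro power_increasing) auto
      then have "C / norm y ^ k \<le> C / norm y" using C(1) y by (intro divide_left_mono mult_pos_pos) auto
      moreover have "norm (?h y) \<le> 1 * norm (g y)"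
        using cutoff_range[of \<delta> y] by (simp add: mult_left_le_one_le)
      ultimately show "norm (?h y) \<le> C * inverse (norm y)"
        using C(2)[of y] y by (force simp: divide_inverse)
    qed
    have "((\<lambda>y::real^'n. C * inverse (norm y)) \<longlongrightarrow> C * 0) at_infinity"
      by (intro tendsto_mult tendsto_const tendsto_inverse_0_at_top filterlim_norm_at_top)
    then show "((\<lambda>y::real^'n. C * inverse (norm y)) \<longlongrightarrow> 0) at_infinity" by simp
  qed
  from conv_vanishes_at_infinity[OF borel_measurable_continuous_onI[OF cutoff_kernel_continuous[OF hom \<delta>(1)]] B this]
  have "\<forall>\<^sub>F x in at_infinity. dist (conv ?h P x) 0 < e / 2"
    using e by (intro tendstoD) auto
  then show "\<forall>\<^sub>F x in at_infinity. dist (conv g P x) 0 < e"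
  proof eventually_elim
    case (elim x)
    then show ?case using \<delta>(2)[of x] norm_triangle_sub[of "conv g P x" "conv ?h P x"]
      by (simp add: dist_norm)
  qed
qed

end

section \<open>Differentiation under the integral sign\<close>

text \<open>
  A segment lies in a translate of the span of one vector, a proper subspace in dimension at least 2.
\<close>
lemma line_null_set:
  fixes x v :: "'a::euclidean_space"
  assumes "2 \<le> DIM('a)"
  shows "(\<lambda>s. x + s *\<^sub>R v) ` {a..b} \<in> null_sets lborel"
proof -
  have "dim (span {v}) < DIM('a)"
    using dim_le_card'[of "{v}"] assms by simp
  then have "negligible (span {v})" by (rule negligible_lowdim)
  then have "negligible ((+) x ` span {v})" by (rule negligible_translation)
  moreover have "(\<lambda>s. x + s *\<^sub>R v) ` {a..b} \<subseteq> (+) x ` span {v}"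
    by (intro image_subsetI imageI span_scale span_base) simp
  ultimately have "negligible ((\<lambda>s. x + s *\<^sub>R v) ` {a..b})" by (rule negligible_subset)
  moreover have "compact ((\<lambda>s. x + s *\<^sub>R v) ` {a..b})"
    by (intro compact_continuous_image continuous_intros) auto
  ultimately show ?thesis
    by (simp add: negligible_iff_null_sets null_sets_completion_iff borel_compact)
qed

text \<open>
  What the differentiation argument needs to know about $P$ in place of a density: no mass on the
  Lebesgue null sets inside $\<Omega>$, and locally uniformly small Riesz potentials.
\<close>
locale locally_riesz_small = borel_prob P for P :: "(real ^ 'n::finite) measure" +
  fixes \<Omega> :: "(real ^ 'n) set" and l :: nat
  assumes dim: "2 \<le> CARD('n)"
    and open_\<Omega>: "open \<Omega>"
    and null_\<Omega>: "\<And>N. N \<in> null_sets lborel \<Longrightarrow> N \<subseteq> \<Omega> \<Longrightarrow> N \<in> null_sets P"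
    and locally_small: "\<And>x. x \<in> \<Omega> \<Longrightarrow> \<exists>r>0. ball x r \<subseteq> \<Omega> \<and> riesz_small P l (ball x r)"
begin

lemma point_null: "x \<in> \<Omega> \<Longrightarrow> {x} \<in> null_sets P"
  by (rule null_\<Omega>) (auto intro: null_setsI)

lemma small_ball:
  assumes "x \<in> \<Omega>" "k \<le> l"
  obtains r where "r > 0" "ball x r \<subseteq> \<Omega>" "riesz_small P k (ball x r)"
proof -
  obtain r where r: "r > 0" "ball x r \<subseteq> \<Omega>" "riesz_small P l (ball x r)"
    using locally_small[OF assms(1)] by blast
  have "riesz_small P k (ball x r)"
    by (rule riesz_small_mono[OF r(3) assms(2)]) (use r(2) point_null in blast)
  with r show ?thesis by (intro that)
qed

lemma kernel_integrable:
  assumes "homogeneous_kernel k g" "k \<le> l" "x \<in> \<Omega>"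
  shows "integrable P (\<lambda>z. g (x - z))"
proof -
  obtain r where r: "r > 0" "ball x r \<subseteq> \<Omega>" "riesz_small P k (ball x r)"
    using small_ball[OF assms(3,2)] by blast
  show ?thesis
    by (rule conv_integrable[OF r(3) _ assms(1)]) (use r point_null in auto)
qed

lemma conv_continuous_on:
  assumes "homogeneous_kernel k g" "k \<le> l"
  shows "continuous_on \<Omega> (conv g P)"
proof (rule continuous_at_imp_continuous_on, intro ballI)
  fix x assume "x \<in> \<Omega>"
  then obtain r where r: "r > 0" "ball x r \<subseteq> \<Omega>" "riesz_small P k (ball x r)"
    using small_ball assms(2) by blast
  have "{y} \<in> null_sets P" if "y \<in> ball x r" for y
    using point_null[OF subsetD[OF r(2) that]] .
  from conv_continuous[OF r(3) this assms(1)]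
  have "\<forall>y\<in>ball x r. isCont (conv g P) y"
    unfolding continuous_on_eq_continuous_at[OF open_ball] .
  moreover have "x \<in> ball x r" using r(1) by simp
  ultimately show "isCont (conv g P) x" by (rule bspec)
qed

text \<open>
  As long as the moving point does not hit $z$, the kernel is smooth along the segment.
\<close>
lemma kernel_FTC_line:
  fixes g :: "real ^ 'n \<Rightarrow> real ^ 'n" and x z :: "real ^ 'n"
  assumes hom: "homogeneous_kernel k g" and ab: "a \<le> b"
    and z: "z \<notin> (\<lambda>s. x + s *\<^sub>R axis i 1) ` {a..b}"
  shows "(LINT s|lborel. indicator {a..b} s *\<^sub>R partial i g (x + s *\<^sub>R axis i 1 - z))
     = g (x + b *\<^sub>R axis i 1 - z) - g (x + a *\<^sub>R axis i 1 - z)"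
proof (rule integral_FTC_atLeastAtMost[OF ab])
  have nz: "x + s *\<^sub>R axis i 1 - z \<noteq> 0" if "s \<in> {a..b}" for s
    using z imageI[OF that, of "\<lambda>s. x + s *\<^sub>R axis i 1"] by auto
  show "((\<lambda>s. g (x + s *\<^sub>R axis i 1 - z)) has_vector_derivative partial i g (x + s *\<^sub>R axis i 1 - z))
          (at s within {a..b})" if "a \<le> s" "s \<le> b" for s
  proof (rule has_vector_derivative_at_within)
    let ?y = "x + s *\<^sub>R axis i 1 - z"
    have "((\<lambda>t. g (?y + t *\<^sub>R axis i 1)) has_vector_derivative partial i g ?y) (at (s - s))"
      using homogeneous_kernel_has_partial[OF hom nz[of s]] that by simp
    moreover have "((\<lambda>t. t - s) has_vector_derivative 1) (at s)"
      by (auto intro!: derivative_eq_intros)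
    ultimately have "((\<lambda>t. g (?y + t *\<^sub>R axis i 1)) \<circ> (\<lambda>t. t - s) has_vector_derivative 1 *\<^sub>R partial i g ?y) (at s)"
      by (intro vector_diff_chain_at)
    then show "((\<lambda>s. g (x + s *\<^sub>R axis i 1 - z)) has_vector_derivative partial i g ?y) (at s)"
      by (simp add: o_def algebra_simps)
  qed
  show "continuous_on {a..b} (\<lambda>s. partial i g (x + s *\<^sub>R axis i 1 - z))"
    by (rule continuous_on_compose2[OF homogeneous_kernel_continuous[OF homogeneous_kernel_partial[OF hom]]])
       (use nz in \<open>auto intro!: continuous_intros\<close>)
qed

text \<open>
  Integrate the previous identity over $z$: the segment lies in $\<Omega>$ and is a null set, so the identity
  holds for almost every $z$. The uniform bound on the convolution with the norm of the differentiated
  kernel justifies the exchange of the integrals. No difference quotient of the singular kernel has to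
  be dominated.
\<close>
lemma conv_FTC_line:
  fixes g :: "real ^ 'n \<Rightarrow> real ^ 'n"
  assumes hom: "homogeneous_kernel k g" and k: "Suc k \<le> l" and ab: "a \<le> b"
    and seg: "\<And>s. s \<in> {a..b} \<Longrightarrow> x + s *\<^sub>R axis i 1 \<in> U" and U: "U \<subseteq> \<Omega>" "riesz_small P (Suc k) U"
  shows "conv g P (x + b *\<^sub>R axis i 1) - conv g P (x + a *\<^sub>R axis i 1)
     = (LINT s|lborel. indicator {a..b} s *\<^sub>R conv (partial i g) P (x + s *\<^sub>R axis i 1))"
proof -
  let ?p = "\<lambda>s. x + s *\<^sub>R axis i 1"
  let ?h = "partial i g"
  have homh: "homogeneous_kernel (Suc k) ?h" by (rule homogeneous_kernel_partial[OF hom])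
  have [measurable]: "?h \<in> borel_measurable borel" by (rule homogeneous_kernel_measurable[OF homh])
  let ?f = "\<lambda>s z. indicator {a..b} s *\<^sub>R ?h (?p s - z)"
  interpret LP: pair_sigma_finite lborel P ..
  obtain M where M: "M \<ge> 0" "\<And>y. y \<in> U \<Longrightarrow> (\<integral>\<^sup>+z. ennreal (norm (?h (y - z))) \<partial>P) \<le> ennreal M"
    using conv_norm_bound[OF U(2) point_null homh] U(1) by blast
  have "integrable (lborel \<Otimes>\<^sub>M P) (case_prod ?f)"
  proof (rule integrableI_bounded)
    show meas: "case_prod ?f \<in> borel_measurable (lborel \<Otimes>\<^sub>M P)" by measurable
    have "(\<integral>\<^sup>+p. ennreal (norm (case_prod ?f p)) \<partial>(lborel \<Otimes>\<^sub>M P))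
        = (\<integral>\<^sup>+s. \<integral>\<^sup>+z. ennreal (norm (?f s z)) \<partial>P \<partial>lborel)"
      using nn_integral_fst[of "\<lambda>p. ennreal (norm (case_prod ?f p))" lborel] meas by simp
    also have "\<dots> \<le> (\<integral>\<^sup>+s. ennreal M * indicator {a..b} s \<partial>lborel)"
    proof (rule nn_integral_mono)
      fix s
      show "(\<integral>\<^sup>+z. ennreal (norm (?f s z)) \<partial>P) \<le> ennreal M * indicator {a..b} s"
        using M(2)[OF seg, of s] by (cases "s \<in> {a..b}") auto
    qed
    also have "\<dots> = ennreal M * ennreal (b - a)"
      using ab by (subst nn_integral_cmult_indicator) auto
    also have "\<dots> < \<infinity>" by (simp add: ennreal_mult_less_top)
    finally show "(\<integral>\<^sup>+p. ennreal (norm (case_prod ?f p)) \<partial>(lborel \<Otimes>\<^sub>M P)) < \<infinity>" .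
  qed
  then have fub: "(LINT z|P. LINT s|lborel. ?f s z) = (LINT s|lborel. LINT z|P. ?f s z)"
    by (rule LP.Fubini_integral)
  have int: "integrable P (\<lambda>z. g (?p s - z))" if "s \<in> {a..b}" for s
    using kernel_integrable[OF hom _ subsetD[OF U(1) seg[OF that]]] k by simp
  have "conv g P (?p b) - conv g P (?p a) = (LINT z|P. g (?p b - z) - g (?p a - z))"
    unfolding conv_def using int[of a] int[of b] ab by (intro Bochner_Integration.integral_diff[symmetric]) auto
  also have "\<dots> = (LINT z|P. LINT s|lborel. ?f s z)"
  proof (rule integral_cong_AE)
    have "?p ` {a..b} \<in> null_sets P"
      by (rule null_\<Omega>[OF line_null_set]) (use seg U(1) dim in auto)
    from AE_not_in[OF this]
    show "AE z in P. g (?p b - z) - g (?p a - z) = (LINT s|lborel. ?f s z)"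
      by eventually_elim (rule kernel_FTC_line[OF hom ab, symmetric])
    show "(\<lambda>z. g (?p b - z) - g (?p a - z)) \<in> borel_measurable P"
      using int[of a] int[of b] ab by (intro borel_measurable_diff borel_measurable_integrable) auto
    show "(\<lambda>z. LINT s|lborel. ?f s z) \<in> borel_measurable P" by measurable
  qed
  also have "\<dots> = (LINT s|lborel. indicator {a..b} s *\<^sub>R conv ?h P (?p s))"
    unfolding fub conv_def by (simp only: integral_scaleR_right)
  finally show ?thesis .
qed

text \<open>
  Along a short segment the convolution is an indefinite integral of a continuous function, so it has
  that function as its derivative.
\<close>
lemma conv_has_partial:
  fixes g :: "real ^ 'n \<Rightarrow> real ^ 'n"
  assumes hom: "homogeneous_kernel k g" and k: "Suc k \<le> l" and x: "x \<in> \<Omega>"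
  shows "((\<lambda>t. conv g P (x + t *\<^sub>R axis i 1)) has_vector_derivative conv (partial i g) P x) (at 0)"
proof -
  let ?p = "\<lambda>s. x + s *\<^sub>R axis i (1::real)"
  let ?H = "\<lambda>s. conv (partial i g) P (?p s)"
  obtain r where r: "r > 0" "ball x r \<subseteq> \<Omega>" "riesz_small P (Suc k) (ball x r)"
    using small_ball[OF x k] by blast
  \<comment> \<open>the integral starts at parameter -b rather than 0, so that 0 is an interior point of the interval\<close>
  define b where "b = r / 2"
  have b: "b > 0" using r(1) by (simp add: b_def)
  have p: "?p s \<in> ball x r" if "s \<in> {- b..b}" for s
    using that r(1) by (simp add: dist_norm b_def norm_axis_1 abs_less_iff)
  have contH: "continuous_on {- b..b} ?H"
    by (rule continuous_on_compose2[OF conv_continuous_on[OF homogeneous_kernel_partial[OF hom] k]])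
       (use p r(2) in \<open>auto intro!: continuous_intros\<close>)
  have eq: "conv g P (?p t) = conv g P (?p (- b)) + integral {- b..t} ?H" if t: "t \<in> {- b..b}" for t
  proof -
    have c: "continuous_on {- b..t} ?H" using contH by (rule continuous_on_subset) (use t in auto)
    have "conv g P (?p t) - conv g P (?p (- b)) = (LINT s:{- b..t}|lborel. ?H s)"
      unfolding set_lebesgue_integral_def
      by (rule conv_FTC_line[OF hom k _ _ r(2,3)]) (use t p in auto)
    also have "\<dots> = integral {- b..t} ?H"
      by (rule set_borel_integral_eq_integral(2)[OF borel_integrable_atLeastAtMost'[OF c]])
    finally show ?thesis by (simp add: algebra_simps)
  qed
  have "((\<lambda>t. integral {- b..t} ?H) has_vector_derivative ?H 0) (at 0 within {- b..b})"
    by (rule integral_has_vector_derivative[OF contH]) (use b in auto)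
  then have "((\<lambda>t. conv g P (?p (- b)) + integral {- b..t} ?H) has_vector_derivative 0 + ?H 0) (at 0 within {- b..b})"
    by (intro has_vector_derivative_add has_vector_derivative_const)
  then have "((\<lambda>t. conv g P (?p t)) has_vector_derivative 0 + ?H 0) (at 0 within {- b..b})"
    by (rule has_vector_derivative_transform[rotated 2]) (use b eq in auto)
  then show ?thesis using b by (simp add: at_within_Icc_at)
qed

lemma conv_C_on:
  fixes g :: "real ^ 'n \<Rightarrow> real ^ 'n"
  assumes "homogeneous_kernel k g" "k + m \<le> l"
  shows "C_on m (conv g P) \<Omega>"
  using assms
proof (induction m arbitrary: k g)
  case 0
  then show ?case using conv_continuous_on[of k g] by simp
next
  case (Suc m)
  show ?case
  proof (rule C_on_SucI[OF open_\<Omega>])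
    show "continuous_on \<Omega> (conv g P)" using conv_continuous_on[of k g] Suc.prems by simp
    show "((\<lambda>t. conv g P (x + t *\<^sub>R axis i 1)) has_vector_derivative conv (partial i g) P x) (at 0)"
      if "x \<in> \<Omega>" for i x
      using conv_has_partial[OF Suc.prems(1) _ that] Suc.prems(2) by simp
    show "C_on m (conv (partial i g) P) \<Omega>" for i
      by (rule Suc.IH[OF homogeneous_kernel_partial[OF Suc.prems(1)]]) (use Suc.prems(2) in simp)
  qed
qed

text \<open>
  Differentiation of one more order is possible because the formula already obtained holds on the whole
  open set. The two claims go together: each step needs the degree of homogeneity reached so far.
\<close>
lemma foldr_partial_conv:
  fixes g :: "real ^ 'n \<Rightarrow> real ^ 'n"
  assumes "homogeneous_kernel 0 g" "length js \<le> l"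
  shows "homogeneous_kernel (length js) (foldr partial js g)"
    and "x \<in> \<Omega> \<Longrightarrow> foldr partial js (conv g P) x = conv (foldr partial js g) P x"
  using assms(2)
proof (induction js arbitrary: x)
  case Nil
  { case 1 show ?case using assms(1) by simp }
  { case 2 show ?case by simp }
next
  case (Cons i js)
  have hom: "homogeneous_kernel (length js) (foldr partial js g)" and le: "Suc (length js) \<le> l"
    if "length (i # js) \<le> l"
    using Cons.IH(1) that by auto
  { case 1 then show ?case using homogeneous_kernel_partial[OF hom] by simp }
  { case 2
    have "partial i (foldr partial js (conv g P)) x = partial i (conv (foldr partial js g) P) x"
      by (rule partial_cong[OF open_\<Omega> 2(1)]) (use Cons.IH(2) 2(2) in auto)
    also have "\<dots> = conv (partial i (foldr partial js g)) P x"
      by (rule partialI(2)[OF conv_has_partial[OF hom le 2(1)]]) (use 2(2) in auto)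
    finally show ?case by simp }
qed

end

section \<open>Regularity and decay of the geometric cdf\<close>

lemma geom_cdf_eq_conv: "geom_cdf P = conv geom_kernel P"
  by (simp add: geom_cdf_def conv_def fun_eq_iff)

theorem proposition4p1:
  fixes P :: "(real ^ 'n::finite) measure"
    and \<Omega> :: "(real ^ 'n) set"
    and f :: "real ^ 'n \<Rightarrow> real"
    and l :: nat
  assumes "CARD('n) \<ge> 2"
    and "open \<Omega>"
    and "1 \<le> l" and "l \<le> CARD('n) - 1"
    and "prob_space P" and "sets P = sets borel"
    and "has_density_over P f \<Omega>"
  shows "((\<exists>p::ennreal. p > ennreal (real CARD('n) / (real CARD('n) - real l)) \<and> Lp_loc_on p \<Omega> f) \<longrightarrow>
            C_on l (geom_cdf P) \<Omega> \<and>
            (\<forall>\<alpha>. mi_order \<alpha> \<le> l \<longrightarrow>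
              (\<forall>x\<in>\<Omega>. integrable P (\<lambda>z. mi_deriv \<alpha> geom_kernel (x - z)) \<and>
                 mi_deriv \<alpha> (geom_cdf P) x = (LINT z|P. mi_deriv \<alpha> geom_kernel (x - z)))))
       \<and> (\<Omega> = UNIV \<and>
          (\<exists>p::ennreal. p > ennreal (real CARD('n) / (real CARD('n) - real l)) \<and> Lp_on p UNIV f) \<longrightarrow>
            (\<forall>\<alpha>. 1 \<le> mi_order \<alpha> \<and> mi_order \<alpha> \<le> l \<longrightarrow>
              (mi_deriv \<alpha> (geom_cdf P) \<longlongrightarrow> 0) at_infinity))"
proof (intro conjI impI allI ballI; (elim conjE exE)?)
  note P = assms(5,6) and dens = assms(7)
  have l: "1 \<le> l" "l < CARD('n)" using assms(1,3,4) by auto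
  interpret borel_prob P
    using P by (simp add: borel_prob_def borel_prob_axioms_def)
  have null: "N \<in> null_sets P" if "N \<in> null_sets lborel" "N \<subseteq> \<Omega>" for N
    by (rule null_sets_density_over[OF P dens that])
  {
    fix p :: ennreal
    assume p: "ennreal (real CARD('n) / (real CARD('n) - real l)) < p" and Lp: "Lp_loc_on p \<Omega> f"
    interpret locally_riesz_small P \<Omega> l
    proof
      fix x assume "x \<in> \<Omega>"
      then obtain r where r: "r > 0" "cball x r \<subseteq> \<Omega>"
        using assms(2) open_contains_cball by blast
      have "riesz_small P l (ball x (r / 2))"
      proof (rule riesz_small_of_Lp[OF P dens l p, where K="cball x r" and \<rho>="r / 2"])
        show "Lp_on p (cball x r) f" using Lp r(2) unfolding Lp_loc_on_def by simp
        show "ball y (r / 2) \<subseteq> cball x r" if "y \<in> ball x (r / 2)" for y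
        proof
          fix z assume "z \<in> ball y (r / 2)"
          then show "z \<in> cball x r" using that dist_triangle[of x z y] by simp
        qed
      qed (use r in auto)
      moreover have "ball x (r / 2) \<subseteq> \<Omega>" using r by (auto simp: subset_iff)
      ultimately show "\<exists>r>0. ball x r \<subseteq> \<Omega> \<and> riesz_small P l (ball x r)"
        using r(1) by (intro exI[of _ "r / 2"]) auto
    qed (use assms null in auto)
    show "C_on l (geom_cdf P) \<Omega>"
      unfolding geom_cdf_eq_conv by (rule conv_C_on[OF homogeneous_geom_kernel]) simp
    fix \<alpha> :: "nat ^ 'n" and x assume \<alpha>: "mi_order \<alpha> \<le> l" and x: "x \<in> \<Omega>"
    obtain js where js: "length js = mi_order \<alpha>"
      "\<And>f :: real ^ 'n \<Rightarrow> real ^ 'n. mi_deriv \<alpha> f = foldr partial js f"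
      using mi_deriv_eq_foldr_partial by blast
    have le: "length js \<le> l" using js(1) \<alpha> by simp
    show "integrable P (\<lambda>z. mi_deriv \<alpha> geom_kernel (x - z))"
      unfolding js(2)
      by (rule kernel_integrable[OF foldr_partial_conv(1)[OF homogeneous_geom_kernel le] le x])
    show "mi_deriv \<alpha> (geom_cdf P) x = (LINT z|P. mi_deriv \<alpha> geom_kernel (x - z))"
      unfolding js(2) geom_cdf_eq_conv
      using foldr_partial_conv(2)[OF homogeneous_geom_kernel le x] by (simp add: conv_def)
  next
    fix p :: ennreal and \<alpha> :: "nat ^ 'n"
    assume U: "\<Omega> = UNIV" and p: "ennreal (real CARD('n) / (real CARD('n) - real l)) < p" and Lp: "Lp_on p UNIV f"
      and \<alpha>: "1 \<le> mi_order \<alpha>" "mi_order \<alpha> \<le> l"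
    have small: "riesz_small P l UNIV"
      by (rule riesz_small_of_Lp[OF P dens l p Lp, where \<rho>=1]) (use U in auto)
    interpret locally_riesz_small P UNIV l
    proof
      fix x :: "real ^ 'n"
      have "riesz_small P l (ball x 1)" using small unfolding riesz_small_def by blast
      then show "\<exists>r>0. ball x r \<subseteq> UNIV \<and> riesz_small P l (ball x r)"
        by (intro exI[of _ 1]) auto
    qed (use assms null U in auto)
    obtain js where js: "length js = mi_order \<alpha>"
      "\<And>f :: real ^ 'n \<Rightarrow> real ^ 'n. mi_deriv \<alpha> f = foldr partial js f"
      using mi_deriv_eq_foldr_partial by blast
    have le: "length js \<le> l" "1 \<le> length js" using js(1) \<alpha> by simp_all
    have "foldr partial js (conv geom_kernel P) = conv (foldr partial js geom_kernel) P"
      using foldr_partial_conv(2)[OF homogeneous_geom_kernel le(1)] by (simp add: fun_eq_iff)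
    moreover have "(conv (foldr partial js geom_kernel) P \<longlongrightarrow> 0) at_infinity"
      by (rule conv_tendsto_0_at_infinity[OF riesz_small_mono[OF small le(1)] _
          foldr_partial_conv(1)[OF homogeneous_geom_kernel le(1)] le(2)]) (simp_all add: point_null)
    ultimately show "(mi_deriv \<alpha> (geom_cdf P) \<longlongrightarrow> 0) at_infinity"
      unfolding js(2) geom_cdf_eq_conv by simp
  }
qed

end
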